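(* Let $A\subseteq\Sigma^*$ be any NP-hard set that is well-pierced. Then there exists a basic junta distribution $\mu=\{\mu_n\}_{n\in\mathbb{N}}$ (for $A$) relative to which $A$ has a deterministic heuristic polynomial-time algorithm; indeed, $A$ even has a deterministic heuristic polynomial-time algorithm relative to $\mu$ whose error weight $\mathrm{Prob}_{\mu_n}[x\notin A\iff\text{the algorithm accepts }x]$ is, for all sufficiently large $n$, bounded by $1/2^{n^2-n}$. Furthermore, the junta $\mu$ is uniformly computable in exponential time, and if in addition $A$ is uniquely well-pierced, the junta $\mu$ is uniformly computable in polynomial time.
   Context: Let $\Sigma=\{0,1\}$. NP-hardness is with respect to polynomial-time many-one reductions $\le_m^p$. **Well-pierced.** A set $L$ is well-pierced (respectively, uniquely well-pierced) if there exist sets $Pos\in\mathrm{P}$ and $Neg\in\mathrm{P}$ such that $Pos\subseteq L$, $Neg\subseteq\overline{L}$, and there is some $N\in\mathbb{N}$ such that at each length $n\ge N$, each of $Pos$ and $Neg$ has at least one string of length $n$ (respectively, exactly one string of length $n$). **Basic junta distribution.** Let $L$ be an NP-hard problem and $\mu=\{\mu_n\}_{n\in\mathbb{N}}$ a family where each $\mu_n$ is a probability distribution on the length $n$ instances. $\mu$ is a basic junta distribution (for $L$) if: 1. Hardness: the restriction of $L$ to $\mu$, i.e., the problem whose possible instances are only $\bigcup_{n\in\mathbb{N}}\{x\mid |x|=n\text{ and }\mu_n(x)>0\}$, is still NP-hard. 2. Balance: there exist constants $c>1$ and $N\in\mathbb{N}$ such that for all $n\ge N$, $1/c\le\mathrm{Prob}_{\mu_n}[x\in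 L]\le 1-1/c$ (where $x$ is a length $n$ instance drawn according to $\mu_n$). 3. Dichotomy: there exists a polynomial $p$ such that for all $n$ and all instances $x$ with $|x|=n$, either $\mu_n(x)\ge 2^{-p(n)}$ or $\mu_n(x)=0$. **Deterministic heuristic polynomial-time algorithm.** An algorithm $\mathcal{A}$ is a deterministic heuristic polynomial-time algorithm for $(L,\mu)$ (for $L$ relative to $\mu$) if $\mathcal{A}$ is a deterministic polynomial-time algorithm and there exist a polynomial $q$ and $N\in\mathbb{N}$ such that for each $n\ge N$, $\mathrm{Prob}_{\mu_n}[x\notin L\iff\mathcal{A}\text{ accepts }x]<\frac1{q(n)}$. **Uniform computability.** $\mu=\{\mu_n\}_{n\in\mathbb{N}}$ is uniformly computable in polynomial time (respectively, exponential time) if there is a polynomial-time (respectively, exponential-time) computable function $f$ such that for each $i$ and each $x$, $f(i,x)$ outputs the value $\mu_i(x)$ (as a rational number). *)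

theory Defs
  imports
    "HOL-Computational_Algebra.Polynomial"
    "HOL-Probability.Probability_Mass_Function"
begin

type_synonym word = "bool list"
type_synonym language = "word set"

text \<open>
  Polynomial bounds are polynomials with natural-number coefficients, \<open>p :: nat poly\<close>.

  The machine model is the deterministic Turing machine with a fixed number of two-way infinite
  tapes. \<^typ>\<open>'q\<close> is the type states are drawn from; complexity classes quantify over machines
  with \<^typ>\<open>'q\<close> instantiated to \<^typ>\<open>nat\<close>, which loses nothing since the state set is finite.
\<close>

datatype sym = Blank | Bit bool | Work nat

datatype dir = Move_Left | Stay | Move_Right

record 'q tm =
  tapes :: nat
  alphabet :: "sym set"
  states :: "'q set"
  start :: 'q
  acc :: 'q
  rej :: 'q
  delta :: "'q \<Rightarrow> sym list \<Rightarrow> 'q \<times> (sym \<times> dir) list"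

text \<open>The list passed to and returned by \<open>delta\<close> has one entry for each tape.\<close>

definition wf_tm :: "'q tm \<Rightarrow> bool" where
  "wf_tm M \<longleftrightarrow>
     1 \<le> tapes M \<and>
     finite (alphabet M) \<and> {Blank, Bit False, Bit True} \<subseteq> alphabet M \<and>
     finite (states M) \<and> {start M, acc M, rej M} \<subseteq> states M \<and> acc M \<noteq> rej M \<and>
     (\<forall>q\<in>states M. \<forall>ss. length ss = tapes M \<and> set ss \<subseteq> alphabet M \<longrightarrow>
        (case delta M q ss of (q', as) \<Rightarrow>
           q' \<in> states M \<and> length as = tapes M \<and> fst ` set as \<subseteq> alphabet M))"

text \<open>A tape is its head position together with the contents of its cells.\<close>

type_synonym tape = "int \<times> (int \<Rightarrow> sym)"
type_synonym 'q config = "'q \<times> tape list"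

fun read :: "tape \<Rightarrow> sym" where
  "read (h, c) = c h"

fun shift :: "dir \<Rightarrow> int" where
  "shift Move_Left = -1"
| "shift Stay = 0"
| "shift Move_Right = 1"

fun act :: "tape \<Rightarrow> sym \<times> dir \<Rightarrow> tape" where
  "act (h, c) (s, d) = (h + shift d, c(h := s))"

definition halted :: "'q tm \<Rightarrow> 'q config \<Rightarrow> bool" where
  "halted M cf \<longleftrightarrow> fst cf \<in> {acc M, rej M}"

definition step :: "'q tm \<Rightarrow> 'q config \<Rightarrow> 'q config" where
  "step M cf =
     (if halted M cf then cf
      else case delta M (fst cf) (map read (snd cf)) of (q', as) \<Rightarrow> (q', map2 act (snd cf) as))"

text \<open>A word is written on the cells \<open>0, 1, 2, \<dots>\<close> of a tape, all other cells being blank. The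
  input is given on the first tape; the output is expected on the last tape, with no condition
  on the position of the head.\<close>

definition cells_of :: "word \<Rightarrow> int \<Rightarrow> sym" where
  "cells_of w i = (if 0 \<le> i \<and> i < int (length w) then Bit (w ! nat i) else Blank)"

definition init :: "'q tm \<Rightarrow> word \<Rightarrow> 'q config" where
  "init M w = (start M, (0, cells_of w) # replicate (tapes M - 1) (0, cells_of []))"

definition run :: "'q tm \<Rightarrow> word \<Rightarrow> nat \<Rightarrow> 'q config" where
  "run M w t = (step M ^^ t) (init M w)"

definition accepts :: "'q tm \<Rightarrow> word \<Rightarrow> bool" where
  "accepts M w \<longleftrightarrow> (\<exists>t. fst (run M w t) = acc M)"

definition poly_time_tm :: "'q tm \<Rightarrow> bool" where
  "poly_time_tm M \<longleftrightarrow>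
     wf_tm M \<and> (\<exists>p :: nat poly. \<forall>w. \<exists>t \<le> poly p (length w). halted M (run M w t))"

text \<open>On input \<open>u\<close>, machine \<open>M\<close> halts with output \<open>v\<close> after at most \<open>T\<close> steps.\<close>

definition computes_within :: "'q tm \<Rightarrow> nat \<Rightarrow> word \<Rightarrow> word \<Rightarrow> bool" where
  "computes_within M T u v \<longleftrightarrow>
     (\<exists>t\<le>T. halted M (run M u t) \<and> snd (last (snd (run M u t))) = cells_of v)"

text \<open>The pair \<open>(x, y)\<close> is encoded by doubling each bit of \<open>x\<close> and separating with \<open>01\<close>.\<close>

definition pair_word :: "word \<Rightarrow> word \<Rightarrow> word" where
  "pair_word x y = concat (map (\<lambda>b. [b, b]) x) @ [False, True] @ y"

definition class_P :: "language set" where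
  "class_P = {L. \<exists>M :: nat tm. poly_time_tm M \<and> L = {w. accepts M w}}"

definition class_NP :: "language set" where
  "class_NP = {L. \<exists>V \<in> class_P. \<exists>p :: nat poly.
     L = {x. \<exists>y. length y \<le> poly p (length x) \<and> pair_word x y \<in> V}}"

definition poly_time_fun :: "(word \<Rightarrow> word) \<Rightarrow> bool" where
  "poly_time_fun f \<longleftrightarrow>
     (\<exists>(M :: nat tm) (p :: nat poly). wf_tm M \<and>
        (\<forall>u. computes_within M (poly p (length u)) u (f u)))"

definition many_one_reducible :: "language \<Rightarrow> language \<Rightarrow> bool" where
  "many_one_reducible B L \<longleftrightarrow> (\<exists>f. poly_time_fun f \<and> (\<forall>x. x \<in> B \<longleftrightarrow> f x \<in> L))"

definition NP_hard :: "language \<Rightarrow> bool" where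
  "NP_hard L \<longleftrightarrow> (\<forall>B \<in> class_NP. many_one_reducible B L)"

text \<open>NP-hardness of the problem that asks membership in \<open>L\<close> but whose only instances are the
  words in \<open>I\<close>: reductions to it have to produce elements of \<open>I\<close>.\<close>

definition NP_hard_restricted :: "language \<Rightarrow> language \<Rightarrow> bool" where
  "NP_hard_restricted I L \<longleftrightarrow>
     (\<forall>B \<in> class_NP. \<exists>f. poly_time_fun f \<and> (\<forall>x. f x \<in> I) \<and> (\<forall>x. x \<in> B \<longleftrightarrow> f x \<in> L))"

definition well_pierced :: "language \<Rightarrow> bool" where
  "well_pierced L \<longleftrightarrow>
     (\<exists>Pos \<in> class_P. \<exists>Neg \<in> class_P. Pos \<subseteq> L \<and> Neg \<subseteq> - L \<and>
        (\<exists>N. \<forall>n\<ge>N. (\<exists>x. x \<in> Pos \<and> length x = n) \<and> (\<exists>x. x \<in> Neg \<and> length x = n)))"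

definition uniquely_well_pierced :: "language \<Rightarrow> bool" where
  "uniquely_well_pierced L \<longleftrightarrow>
     (\<exists>Pos \<in> class_P. \<exists>Neg \<in> class_P. Pos \<subseteq> L \<and> Neg \<subseteq> - L \<and>
        (\<exists>N. \<forall>n\<ge>N. (\<exists>!x. x \<in> Pos \<and> length x = n) \<and> (\<exists>!x. x \<in> Neg \<and> length x = n)))"

definition distribution_family :: "(nat \<Rightarrow> word pmf) \<Rightarrow> bool" where
  "distribution_family \<mu> \<longleftrightarrow> (\<forall>n. set_pmf (\<mu> n) \<subseteq> {x. length x = n})"

definition basic_junta :: "language \<Rightarrow> (nat \<Rightarrow> word pmf) \<Rightarrow> bool" where
  "basic_junta L \<mu> \<longleftrightarrow>
     distribution_family \<mu> \<and>
     NP_hard_restricted (\<Union>n. {x. length x = n \<and> pmf (\<mu> n) x > 0}) L \<and>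
     (\<exists>c>1. \<exists>N. \<forall>n\<ge>N. 1 / c \<le> measure_pmf.prob (\<mu> n) {x. x \<in> L} \<and>
        measure_pmf.prob (\<mu> n) {x. x \<in> L} \<le> 1 - 1 / c) \<and>
     (\<exists>p :: nat poly. \<forall>n x. length x = n \<longrightarrow>
        pmf (\<mu> n) x \<ge> 1 / 2 ^ poly p n \<or> pmf (\<mu> n) x = 0)"

definition error_weight :: "language \<Rightarrow> (nat \<Rightarrow> word pmf) \<Rightarrow> 'q tm \<Rightarrow> nat \<Rightarrow> real" where
  "error_weight L \<mu> M n = measure_pmf.prob (\<mu> n) {x. x \<notin> L \<longleftrightarrow> accepts M x}"

definition heuristic_poly_time :: "language \<Rightarrow> (nat \<Rightarrow> word pmf) \<Rightarrow> 'q tm \<Rightarrow> bool" where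
  "heuristic_poly_time L \<mu> M \<longleftrightarrow>
     poly_time_tm M \<and>
     (\<exists>q :: nat poly. \<exists>N. \<forall>n\<ge>N. error_weight L \<mu> M n < 1 / real (poly q n))"

text \<open>Binary notation, least significant bit first and without leading zeros; \<open>0\<close> is the empty
  word.\<close>

fun nat_word :: "nat \<Rightarrow> word" where
  "nat_word n = (if n = 0 then [] else odd n # nat_word (n div 2))"

declare nat_word.simps [simp del]

definition int_word :: "int \<Rightarrow> word" where
  "int_word z = (z < 0) # nat_word (nat \<bar>z\<bar>)"

text \<open>\<open>quotient_of\<close> yields the fraction in lowest terms with positive denominator.\<close>

definition rat_word :: "rat \<Rightarrow> word" where
  "rat_word r = (case quotient_of r of (a, b) \<Rightarrow> pair_word (int_word a) (nat_word (nat b)))"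

text \<open>Some machine maps each pair \<open>(i, x)\<close> to the value of \<open>\<mu>\<^sub>i(x)\<close>, which thereby has to be
  rational, within a number of steps bounded by \<open>T\<close> in the length of the encoded pair.\<close>

definition uniformly_computable_in :: "(nat \<Rightarrow> nat) \<Rightarrow> (nat \<Rightarrow> word pmf) \<Rightarrow> bool" where
  "uniformly_computable_in T \<mu> \<longleftrightarrow>
     (\<exists>(M :: nat tm) (f :: nat \<Rightarrow> word \<Rightarrow> rat). wf_tm M \<and>
        (\<forall>i x. pmf (\<mu> i) x = of_rat (f i x) \<and>
           (let u = pair_word (nat_word i) x
            in computes_within M (T (length u)) u (rat_word (f i x)))))"

definition uniformly_computable_poly_time :: "(nat \<Rightarrow> word pmf) \<Rightarrow> bool" where
  "uniformly_computable_poly_time \<mu> \<longleftrightarrow>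
     (\<exists>p :: nat poly. uniformly_computable_in (poly p) \<mu>)"

definition uniformly_computable_exp_time :: "(nat \<Rightarrow> word pmf) \<Rightarrow> bool" where
  "uniformly_computable_exp_time \<mu> \<longleftrightarrow>
     (\<exists>p :: nat poly. uniformly_computable_in (\<lambda>n. 2 ^ poly p n) \<mu>)"

end

(*
  Each long enough length gets one special positive word and one special negative word. They share
  the probability left over when all other words of length n receive 2^(-n^2), so the support is
  everything (hardness is inherited), both answers have probability at least 1/4, and the
  polynomial-time machine for the positive words errs only on nonspecial words, of total weight
  at most 2^n / 2^(n^2). Without uniqueness the special words are the least positive and the least
  negative one, which can be found in exponential time by exhaustive search. The weight of a
  special word is (2^(n^2-1) - 2^(n-1) + 1) / 2^(n^2), whose numerator is odd, so that both parts of
  the reduced fraction are simple enough to be written down by nested loops over the input.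

  Machines are obtained from a small imperative language whose programs compile to Turing machines
  that use the stack of pending statements as their state. Finite memory is kept on extra tapes
  whose heads never move.
*)

theory Submission
  imports Defs
begin

section \<open>Programs and their compilation\<close>

text \<open>The weight 2^(-n^2) meets two demands at once: all nonspecial words together weigh at
  most 2^n / 2^(n^2) = 1 / 2^(n^2-n), which is the required error bound, and every word keeps a mass
  whose logarithm is polynomial in n, as dichotomy with full support asks. A special word gets half
  of what is left, (2^(n^2) - (2^n - 2)) / 2 units of that size. Below the length where piercing
  starts, special words may be missing, and the distribution is uniform there. The heuristic machine
  decides the whole set of piercing positives, which is in P and contains the special positive word;
  only the evaluation of the weights has to locate the least words. Most of the work is due to
  uniform computability, a claim about concrete machines with exact output. The delicate point is
  the exhaustive search, which simulates one machine again and again on the same tapes: a simulated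
  machine can leave gaps of blanks between its symbols, so that a cleaning loop could not tell where
  the used part ends. The simulation therefore pads blanks in the used part.\<close>

datatype prog =
    Act "(nat \<Rightarrow> sym) \<Rightarrow> nat \<rightharpoonup> sym \<times> dir"
  | Seq prog prog  (infixr \<open>;;\<close> 60)
  | Cond "(nat \<Rightarrow> sym) \<Rightarrow> bool" prog prog
  | While "(nat \<Rightarrow> sym) \<Rightarrow> bool" prog

section \<open>Environments and timed execution of programs\<close>

type_synonym env = "nat \<Rightarrow> tape"

definition reads :: "env \<Rightarrow> nat \<Rightarrow> sym" where
  "reads ts i = read (ts i)"

definition upd :: "env \<Rightarrow> (nat \<rightharpoonup> sym \<times> dir) \<Rightarrow> env" where
  "upd ts m i = (case m i of None \<Rightarrow> ts i | Some a \<Rightarrow> act (ts i) a)"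

lemma upd_empty [simp]: "upd ts Map.empty = ts"
  by (auto simp: upd_def)

lemma upd_map_upd [simp]: "upd ts (m(j \<mapsto> a)) = (upd ts m)(j := act (ts j) a)"
  by (auto simp: upd_def)

text \<open>Writing back the scanned symbol is permitted even outside \<open>G\<close>, so that
  moving a head requires no invariant on the tape contents.\<close>

definition ok :: "nat \<Rightarrow> sym set \<Rightarrow> (nat \<Rightarrow> sym) \<Rightarrow> (nat \<rightharpoonup> sym \<times> dir) \<Rightarrow> bool" where
  "ok K G rd m \<longleftrightarrow> (\<forall>i s d. m i = Some (s, d) \<longrightarrow> i < K \<and> (s \<in> G \<or> s = rd i))"

lemma ok_empty [simp]: "ok K G rd Map.empty"
  by (auto simp: ok_def)

lemma ok_map_upd [simp]:
  "ok K G rd m \<Longrightarrow> j < K \<Longrightarrow> s \<in> G \<or> s = rd j \<Longrightarrow> ok K G rd (m(j \<mapsto> (s, d)))"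
  by (auto simp: ok_def)

text \<open>The number is an upper bound on the running time.\<close>

inductive exec :: "nat \<Rightarrow> sym set \<Rightarrow> prog \<Rightarrow> env \<Rightarrow> nat \<Rightarrow> env \<Rightarrow> bool" for K G where
  Act: "ok K G (reads ts) (f (reads ts)) \<Longrightarrow> 1 \<le> n \<Longrightarrow>
    exec K G (Act f) ts n (upd ts (f (reads ts)))"
| Seq: "exec K G p ts m ts' \<Longrightarrow> exec K G q ts' n ts'' \<Longrightarrow> m + n + 1 \<le> k \<Longrightarrow> exec K G (p ;; q) ts k ts''"
| CondT: "b (reads ts) \<Longrightarrow> exec K G p ts n ts' \<Longrightarrow> n + 1 \<le> k \<Longrightarrow> exec K G (Cond b p q) ts k ts'"
| CondF: "\<not> b (reads ts) \<Longrightarrow> exec K G q ts n ts' \<Longrightarrow> n + 1 \<le> k \<Longrightarrow> exec K G (Cond b p q) ts k ts'"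
| WhileT: "b (reads ts) \<Longrightarrow> exec K G p ts m ts' \<Longrightarrow> exec K G (While b p) ts' n ts'' \<Longrightarrow>
    m + n + 1 \<le> k \<Longrightarrow> exec K G (While b p) ts k ts''"
| WhileF: "\<not> b (reads ts) \<Longrightarrow> 1 \<le> k \<Longrightarrow> exec K G (While b p) ts k ts"

lemma exec_mono: "exec K G p ts n ts' \<Longrightarrow> n \<le> n' \<Longrightarrow> exec K G p ts n' ts'"
  by (erule exec.cases) (blast intro: exec.intros le_trans)+

lemma exec_eq: "exec K G p ts n ts' \<Longrightarrow> ts' = ts'' \<Longrightarrow> n \<le> n' \<Longrightarrow> exec K G p ts n' ts''"
  using exec_mono by blast

lemma exec_Act:
  "ok K G (reads ts) (f (reads ts)) \<Longrightarrow> ts' = upd ts (f (reads ts)) \<Longrightarrow> 1 \<le> n \<Longrightarrow> exec K G (Act f) ts n ts'"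
  using exec.Act by blast

text \<open>The stacks that occur while \<open>p\<close> runs on top of \<open>c\<close>, without
  \<open>c\<close> itself. A loop body runs on top of the loop statement, which is not unfolded any
  further; this keeps the set finite.\<close>

fun reach :: "prog \<Rightarrow> prog list \<Rightarrow> prog list set" where
  "reach (Act f) c = {Act f # c}"
| "reach (p ;; q) c = insert ((p ;; q) # c) (reach p (q # c) \<union> reach q c)"
| "reach (Cond b p q) c = insert (Cond b p q # c) (reach p c \<union> reach q c)"
| "reach (While b p) c = insert (While b p # c) (reach p (While b p # c))"

fun next_cont :: "(nat \<Rightarrow> sym) \<Rightarrow> prog list \<Rightarrow> prog list" where
  "next_cont rd [] = []"
| "next_cont rd (Act f # c) = c"
| "next_cont rd ((p ;; q) # c) = p # q # c"
| "next_cont rd (Cond b p q # c) = (if b rd then p else q) # c"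
| "next_cont rd (While b p # c) = (if b rd then p # While b p # c else c)"

fun action :: "(nat \<Rightarrow> sym) \<Rightarrow> prog list \<Rightarrow> nat \<rightharpoonup> sym \<times> dir" where
  "action rd (Act f # c) = f rd"
| "action rd c = Map.empty"

lemma finite_reach: "finite (reach p c)"
  by (induction p arbitrary: c) auto

lemma Cons_in_reach: "p # c \<in> reach p c"
  by (cases p) auto

lemma next_cont_reach: "d \<in> reach p c \<Longrightarrow> next_cont rd d \<in> insert c (reach p c)"
proof (induction p arbitrary: c)
  case (Seq p1 p2)
  then show ?case using Cons_in_reach[of p1 "p2 # c"] Cons_in_reach[of p2 c]
    by simp (metis next_cont.simps(3))
next
  case (Cond b p1 p2)
  then show ?case using Cons_in_reach[of p1 c] Cons_in_reach[of p2 c] by auto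
next
  case (While b p)
  then show ?case using Cons_in_reach[of p "While b p # c"] by (cases "b rd") auto
qed auto

definition conts :: "prog \<Rightarrow> prog list set" where
  "conts p = insert [] (reach p [])"

text \<open>Continuations contain functions, so only the finitely many reachable ones can be numbered;
  \<open>0\<close> and \<open>1\<close> are kept for the two halting states.\<close>

definition code :: "prog \<Rightarrow> prog list \<Rightarrow> nat" where
  "code p c = (SOME f. inj_on f (conts p)) c + 2"

definition decode :: "prog \<Rightarrow> nat \<Rightarrow> prog list" where
  "decode p = inv_into (conts p) (code p)"

lemma decode_code: "c \<in> conts p \<Longrightarrow> decode p (code p c) = c"
proof -
  have "finite (conts p)" by (simp add: conts_def finite_reach)
  then have "\<exists>f :: prog list \<Rightarrow> nat. inj_on f (conts p)"
    using finite_imp_inj_to_nat_seg by blast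
  then have "inj_on (SOME f :: prog list \<Rightarrow> nat. inj_on f (conts p)) (conts p)"
    by (rule someI_ex)
  then have "inj_on (code p) (conts p)" by (simp add: code_def inj_on_def)
  then show "c \<in> conts p \<Longrightarrow> decode p (code p c) = c"
    by (simp add: decode_def)
qed

definition symbols_read :: "nat \<Rightarrow> sym list \<Rightarrow> nat \<Rightarrow> sym" where
  "symbols_read K ss i = (if i < K then ss ! i else Blank)"

text \<open>Replacing forbidden symbols by \<open>Blank\<close> makes \<open>wf_tm\<close> hold for
  every program; under \<open>ok\<close> the replacement never happens. The empty stack takes one
  last step, in which \<open>a\<close> turns the scanned symbols into the verdict.\<close>

definition tm_of :: "nat \<Rightarrow> sym set \<Rightarrow> prog \<Rightarrow> ((nat \<Rightarrow> sym) \<Rightarrow> bool) \<Rightarrow> nat tm" where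
  "tm_of K G p a = \<lparr>tapes = K, alphabet = G, states = {0, 1} \<union> code p ` conts p,
     start = code p [p], acc = 0, rej = 1,
     delta = (\<lambda>q ss. let rd = symbols_read K ss; c = decode p q in
       (if q \<in> {0, 1} then q
        else if c = [] then (if a rd then 0 else 1) else code p (next_cont rd c),
        map (\<lambda>i. case action rd c i of None \<Rightarrow> (ss ! i, Stay)
          | Some (s, d) \<Rightarrow> (if s \<in> G \<or> s = ss ! i then s else Blank, d)) [0..<K]))\<rparr>"

lemma tm_of_simps [simp]:
  "tapes (tm_of K G p a) = K" "alphabet (tm_of K G p a) = G"
  "acc (tm_of K G p a) = 0" "rej (tm_of K G p a) = 1" "start (tm_of K G p a) = code p [p]"
  by (auto simp: tm_of_def)

lemma next_cont_conts: "c \<in> conts p \<Longrightarrow> next_cont rd c \<in> conts p"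
  using next_cont_reach[of c p "[]" rd] by (auto simp: conts_def)

lemma wf_tm_of:
  assumes "1 \<le> K" "finite G" "{Blank, Bit False, Bit True} \<subseteq> G"
  shows "wf_tm (tm_of K G p a)"
proof -
  have 1: "finite (conts p)" "[p] \<in> conts p"
    by (simp_all add: conts_def finite_reach Cons_in_reach)
  have 2: "fst (delta (tm_of K G p a) q ss) \<in> states (tm_of K G p a)"
    if "q \<in> states (tm_of K G p a)" for q ss
    using that next_cont_conts[of _ p "symbols_read K ss"]
    by (auto simp: tm_of_def Let_def decode_code)
  have 3: "fst ` set (snd (delta (tm_of K G p a) q ss)) \<subseteq> G" if "length ss = K" "set ss \<subseteq> G" for q ss
  proof -
    have "ss ! i \<in> G" if "i < K" for i using that \<open>length ss = K\<close> \<open>set ss \<subseteq> G\<close> by auto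
    then show ?thesis using assms(3)
      by (auto simp: tm_of_def Let_def split: option.splits)
  qed
  have 4: "length (snd (delta (tm_of K G p a) q ss)) = K" for q ss
    by (simp add: tm_of_def Let_def)
  show ?thesis
    using 1 2 3 4 assms unfolding wf_tm_def
    by (auto simp: case_prod_beta tm_of_def[of K G p a] simp del: One_nat_def)
qed

abbreviation blank_tape :: tape where
  "blank_tape \<equiv> (0, \<lambda>_. Blank)"

definition listed :: "nat \<Rightarrow> env \<Rightarrow> tape list" where
  "listed K ts = map ts [0..<K]"

lemma step_tm_of:
  assumes "c \<in> conts p" and blank: "\<And>i. K \<le> i \<Longrightarrow> ts i = blank_tape"
    and ok: "ok K G (reads ts) (action (reads ts) c)"
  shows "step (tm_of K G p a) (code p c, listed K ts) =
    (if c = [] then (if a (reads ts) then 0 else 1) else code p (next_cont (reads ts) c),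
     listed K (upd ts (action (reads ts) c)))"
proof -
  have c2: "code p c \<ge> 2" by (simp add: code_def)
  \<comment> \<open>An environment has infinitely many tapes, the machine only \<open>K\<close>.
    Beyond \<open>K\<close> only blanks are scanned, which is the default of
    \<open>symbols_read\<close>.\<close>
  have rd: "symbols_read K (map read (listed K ts)) = reads ts"
    using blank by (auto simp: symbols_read_def reads_def listed_def)
  have 1: "map2 act (listed K ts)
    (map (\<lambda>i. case action (reads ts) c i of None \<Rightarrow> (map read (listed K ts) ! i, Stay)
          | Some (s, d) \<Rightarrow> (if s \<in> G \<or> s = map read (listed K ts) ! i then s else Blank, d)) [0..<K])
    = listed K (upd ts (action (reads ts) c))"
  proof (rule nth_equalityI, goal_cases)
    case (2 i)
    then have i: "i < K" by (simp add: listed_def)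
    obtain h cl where ti: "ts i = (h, cl)" by force
    show ?case using i ok[unfolded ok_def, rule_format, of i] ti
      by (auto simp: listed_def upd_def reads_def split: option.splits)
  qed (simp add: listed_def)
  have 2: "\<not> halted (tm_of K G p a) (code p c, listed K ts)"
    using c2 by (simp add: halted_def)
  have 3: "delta (tm_of K G p a) (code p c) (map read (listed K ts)) =
    (if c = [] then (if a (reads ts) then 0 else 1) else code p (next_cont (reads ts) c),
     map (\<lambda>i. case action (reads ts) c i of None \<Rightarrow> (map read (listed K ts) ! i, Stay)
          | Some (s, d) \<Rightarrow> (if s \<in> G \<or> s = map read (listed K ts) ! i then s else Blank, d)) [0..<K])"
    unfolding tm_of_def Let_def using c2 decode_code[OF assms(1)] by (simp add: rd cong: if_cong split del: if_split)
  show ?thesis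
    unfolding step_def fst_conv snd_conv 3 using 2 by (simp only: if_False split_conv 1)
qed

text \<open>The 1 added in the rules of \<open>exec\<close> pays for the machine step that unfolds
  the statement on top of the stack. The continuation \<open>c\<close> has to be arbitrary because
  subprograms run on top of pending statements.\<close>

lemma exec_steps:
  assumes "exec K G p ts n ts'" "insert c (reach p c) \<subseteq> conts q" "\<And>i. K \<le> i \<Longrightarrow> ts i = blank_tape"
  shows "(\<exists>m\<le>n. (step (tm_of K G q a) ^^ m) (code q (p # c), listed K ts) = (code q c, listed K ts'))
    \<and> (\<forall>i\<ge>K. ts' i = blank_tape)"
  using assms
proof (induction arbitrary: c rule: exec.induct)
  case (Act ts f n)
  have "step (tm_of K G q a) (code q (Act f # c), listed K ts) = (code q c, listed K (upd ts (f (reads ts))))"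
    using step_tm_of[of "Act f # c" q K ts G a] Act by auto
  then have "(step (tm_of K G q a) ^^ 1) (code q (Act f # c), listed K ts) = (code q c, listed K (upd ts (f (reads ts))))"
    by simp
  moreover have "upd ts (f (reads ts)) i = blank_tape" if "i \<ge> K" for i
    using Act.prems(2)[OF that] Act.hyps(1)[unfolded ok_def, rule_format, of i] that
    by (force simp: upd_def split: option.splits)
  ultimately show ?case using Act.hyps(2) by blast
next
  case (Seq p ts m ts' r n ts'' k)
  have "step (tm_of K G q a) (code q ((p ;; r) # c), listed K ts) = (code q (p # r # c), listed K ts)"
    using step_tm_of[of "(p ;; r) # c" q K ts G a] Seq by auto
  then have s0: "(step (tm_of K G q a) ^^ 1) (code q ((p ;; r) # c), listed K ts) = (code q (p # r # c), listed K ts)"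
    by simp
  obtain m' where m': "m' \<le> m" "(step (tm_of K G q a) ^^ m') (code q (p # r # c), listed K ts) = (code q (r # c), listed K ts')"
    and b: "\<forall>i\<ge>K. ts' i = blank_tape"
    using Seq.IH(1)[of "r # c"] Seq.prems Cons_in_reach[of r c] by auto
  obtain n' where n': "n' \<le> n" "(step (tm_of K G q a) ^^ n') (code q (r # c), listed K ts') = (code q c, listed K ts'')"
    and b: "\<forall>i\<ge>K. ts'' i = blank_tape"
    using Seq.IH(2)[of "c"] Seq.prems b by auto
  have "(step (tm_of K G q a) ^^ (n' + (m' + 1))) (code q ((p ;; r) # c), listed K ts) = (code q c, listed K ts'')"
    unfolding funpow_add comp_def using s0 m' n' by simp
  moreover have "n' + (m' + 1) \<le> k" using m' n' Seq.hyps by linarith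
  ultimately show ?case using b by blast
next
  case (CondT b ts p n ts' k r)
  have "step (tm_of K G q a) (code q (Cond b p r # c), listed K ts) = (code q (p # c), listed K ts)"
    using step_tm_of[of "Cond b p r # c" q K ts G a] CondT by auto
  then have s0: "(step (tm_of K G q a) ^^ 1) (code q (Cond b p r # c), listed K ts) = (code q (p # c), listed K ts)"
    by simp
  obtain m' where m': "m' \<le> n" "(step (tm_of K G q a) ^^ m') (code q (p # c), listed K ts) = (code q c, listed K ts')"
    and b: "\<forall>i\<ge>K. ts' i = blank_tape"
    using CondT.IH[of c] CondT.prems by auto
  have "(step (tm_of K G q a) ^^ (m' + 1)) (code q (Cond b p r # c), listed K ts) = (code q c, listed K ts')"
    unfolding funpow_add comp_def using s0 m' by simp
  moreover have "m' + 1 \<le> k" using m' CondT.hyps by linarith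
  ultimately show ?case using b by blast
next
  case (CondF b ts r n ts' k p)
  have "step (tm_of K G q a) (code q (Cond b p r # c), listed K ts) = (code q (r # c), listed K ts)"
    using step_tm_of[of "Cond b p r # c" q K ts G a] CondF by auto
  then have s0: "(step (tm_of K G q a) ^^ 1) (code q (Cond b p r # c), listed K ts) = (code q (r # c), listed K ts)"
    by simp
  obtain m' where m': "m' \<le> n" "(step (tm_of K G q a) ^^ m') (code q (r # c), listed K ts) = (code q c, listed K ts')"
    and b: "\<forall>i\<ge>K. ts' i = blank_tape"
    using CondF.IH[of c] CondF.prems by auto
  have "(step (tm_of K G q a) ^^ (m' + 1)) (code q (Cond b p r # c), listed K ts) = (code q c, listed K ts')"
    unfolding funpow_add comp_def using s0 m' by simp
  moreover have "m' + 1 \<le> k" using m' CondF.hyps by linarith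
  ultimately show ?case using b by blast
next
  case (WhileT b ts p m ts' n ts'' k)
  have "step (tm_of K G q a) (code q (While b p # c), listed K ts) = (code q (p # While b p # c), listed K ts)"
    using step_tm_of[of "While b p # c" q K ts G a] WhileT by auto
  then have s0: "(step (tm_of K G q a) ^^ 1) (code q (While b p # c), listed K ts) = (code q (p # While b p # c), listed K ts)"
    by simp
  obtain m' where m': "m' \<le> m" "(step (tm_of K G q a) ^^ m') (code q (p # While b p # c), listed K ts) = (code q (While b p # c), listed K ts')"
    and b: "\<forall>i\<ge>K. ts' i = blank_tape"
    using WhileT.IH(1)[of "While b p # c"] WhileT.prems by auto
  obtain n' where n': "n' \<le> n" "(step (tm_of K G q a) ^^ n') (code q (While b p # c), listed K ts') = (code q c, listed K ts'')"
    and b: "\<forall>i\<ge>K. ts'' i = blank_tape"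
    using WhileT.IH(2)[of "c"] WhileT.prems b by auto
  have "(step (tm_of K G q a) ^^ (n' + (m' + 1))) (code q (While b p # c), listed K ts) = (code q c, listed K ts'')"
    unfolding funpow_add comp_def using s0 m' n' by simp
  moreover have "n' + (m' + 1) \<le> k" using m' n' WhileT.hyps by linarith
  ultimately show ?case using b by blast
next
  case (WhileF b ts k p)
  have "step (tm_of K G q a) (code q (While b p # c), listed K ts) = (code q c, listed K ts)"
    using step_tm_of[of "While b p # c" q K ts G a] WhileF by auto
  then have "(step (tm_of K G q a) ^^ 1) (code q (While b p # c), listed K ts) = (code q c, listed K ts)"
    by simp
  then show ?case using WhileF by blast
qed

definition init_env :: "word \<Rightarrow> env" where
  "init_env w = (\<lambda>_. blank_tape)(0 := (0, cells_of w))"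

lemma cells_of_Nil [simp]: "cells_of [] = (\<lambda>_. Blank)"
  by (auto simp: cells_of_def)

lemma listed_init_env: "1 \<le> K \<Longrightarrow> listed K (init_env w) = (0, cells_of w) # replicate (K - 1) blank_tape"
  by (rule nth_equalityI) (auto simp: listed_def init_env_def nth_Cons split: nat.splits)

theorem run_tm_of:
  assumes "exec K G p (init_env w) n ts" "1 \<le> K"
  shows "\<exists>t\<le>n + 1. run (tm_of K G p a) w t = (if a (reads ts) then 0 else 1, listed K ts)"
proof -
  have "init_env w i = blank_tape" if "K \<le> i" for i using that assms(2) by (auto simp: init_env_def)
  then obtain m where m: "m \<le> n" "(step (tm_of K G p a) ^^ m) (code p [p], listed K (init_env w)) = (code p [], listed K ts)"
    and b: "\<forall>i\<ge>K. ts i = blank_tape"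
    using exec_steps[OF assms(1), of "[]" p a] by (auto simp: conts_def)
  have "step (tm_of K G p a) (code p [], listed K ts) = (if a (reads ts) then 0 else 1, listed K ts)"
    using step_tm_of[of "[]" p K ts G a] b by (auto simp: conts_def)
  then have "(step (tm_of K G p a) ^^ Suc m) (init (tm_of K G p a) w) = (if a (reads ts) then 0 else 1, listed K ts)"
    using m listed_init_env[OF assms(2), of w] by (simp add: init_def)
  then show ?thesis using m(1) unfolding run_def by (metis add.commute add_le_mono1 plus_1_eq_Suc)
qed

section \<open>Basic programs\<close>

text \<open>A word in the making, with the head on the first free cell. The offset is arbitrary
  because erasing a tape leaves its head at an unknown position, where the next word then
  begins.\<close>

definition wtape :: "int \<Rightarrow> word \<Rightarrow> tape" where
  "wtape off v = (off + int (length v), \<lambda>z. cells_of v (z - off))"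

definition var :: "sym \<Rightarrow> tape" where
  "var s = (0, (\<lambda>_. Blank)(0 := s))"

lemma read_var [simp]: "read (var s) = s"
  by (simp add: var_def)

lemma act_var [simp]: "act (var a) (s, Stay) = var s"
  by (simp add: var_def)

lemma var_Blank: "var Blank = blank_tape"
  by (auto simp: var_def)

lemma cells_of_nth [simp]: "k < length w \<Longrightarrow> cells_of w (int k) = Bit (w ! k)"
  by (simp add: cells_of_def)

lemma cells_of_length [simp]: "length w \<le> k \<Longrightarrow> cells_of w (int k) = Blank"
  by (simp add: cells_of_def)

lemma cells_of_snoc: "(cells_of w)(int (length w) := Bit b) = cells_of (w @ [b])"
  by (auto simp: cells_of_def nth_append fun_eq_iff)

lemma cells_of_update: "k < length w \<Longrightarrow> (cells_of w)(int k := Bit b) = cells_of (w[k := b])"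
  by (auto simp: cells_of_def fun_eq_iff nth_list_update)

lemma act_wtape [simp]: "act (wtape off v) (Bit b, Move_Right) = wtape off (v @ [b])"
proof -
  have "((\<lambda>z. cells_of v (z - off))(off + int (length v) := Bit b)) z = cells_of (v @ [b]) (z - off)" for z
    unfolding cells_of_snoc[symmetric] by auto
  then show ?thesis by (auto simp: wtape_def)
qed

lemma wtape_Nil: "wtape off [] = (off, \<lambda>_. Blank)"
  by (simp add: wtape_def)

lemma act_read: "act t (read t, d) = (fst t + shift d, snd t)"
  by (cases t) auto

lemma read_alt: "read t = snd t (fst t)"
  by (cases t) auto

definition mv :: "nat set \<Rightarrow> dir \<Rightarrow> prog" where
  "mv J d = Act (\<lambda>rd i. if i \<in> J then Some (rd i, d) else None)"

definition slide :: "nat set \<Rightarrow> int \<Rightarrow> env \<Rightarrow> env" where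
  "slide J k ts = (\<lambda>i. if i \<in> J then (fst (ts i) + k, snd (ts i)) else ts i)"

lemma slide_slide [simp]: "slide J a (slide J b ts) = slide J (a + b) ts"
  by (auto simp: slide_def)

lemma slide_0 [simp]: "slide J 0 ts = ts"
  by (auto simp: slide_def)

text \<open>Tape \<open>j\<close> alone decides when to stop; the other heads in \<open>J\<close>
  move the same distance, so heads that advanced together return together, even on words at unknown
  offsets. The first move precedes the test because the head may stand on the blank behind the
  word.\<close>

definition rewind :: "nat \<Rightarrow> nat set \<Rightarrow> prog" where
  "rewind j J = mv J Move_Left ;; While (\<lambda>rd. rd j \<noteq> Blank) (mv J Move_Left) ;; mv J Move_Right"

definition copy :: "nat \<Rightarrow> nat set \<Rightarrow> prog" where
  "copy s J = While (\<lambda>rd. rd s \<noteq> Blank)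
     (Act (\<lambda>rd i. if i \<in> insert s J then Some (rd s, Move_Right) else None))"

section \<open>Binary counters of fixed length\<close>

fun val :: "word \<Rightarrow> nat" where
  "val [] = 0"
| "val (b # w) = of_bool b + 2 * val w"

text \<open>The least significant bit comes first. The length is kept, so zero wraps around to all
  ones.\<close>

fun dec :: "word \<Rightarrow> word" where
  "dec [] = []"
| "dec (b # w) = (if b then False # w else True # dec w)"

text \<open>Subtraction with borrow: leading zeros become ones until a one is found and cleared.
  Reaching the blank behind the word means that the value was zero; this underflow is reported by
  writing \<open>s\<close> on tape \<open>f\<close>.\<close>

definition decr :: "nat \<Rightarrow> nat \<Rightarrow> sym \<Rightarrow> prog" where
  "decr j f s =
     While (\<lambda>rd. rd j = Bit False) (Act (\<lambda>rd. [j \<mapsto> (Bit True, Move_Right)])) ;;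
     Cond (\<lambda>rd. rd j = Blank) (Act (\<lambda>rd. [f \<mapsto> (s, Stay)])) (Act (\<lambda>rd. [j \<mapsto> (Bit False, Stay)])) ;;
     rewind j {j}"

lemma length_dec [simp]: "length (dec w) = length w"
  by (induction w) auto

lemma val_dec: "0 < val w \<Longrightarrow> val (dec w) = val w - 1"
  by (induction w) auto

lemma val_replicate_False [simp]: "val (replicate m False) = 0"
  by (induction m) auto

lemma dec_replicate_False: "dec (replicate m False) = replicate m True"
  by (induction m) auto

lemma dec_replicate_False_True: "dec (replicate m False @ True # v) = replicate m True @ False # v"
  by (induction m) auto

lemma word_cases:
  obtains m where "w = replicate m False" "val w = 0"
  | m v where "w = replicate m False @ True # v" "0 < val w"
proof -
  have "(\<exists>m. w = replicate m False) \<and> val w = 0 \<or> (\<exists>m v. w = replicate m False @ True # v) \<and> 0 < val w"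
  proof (induction w)
    case (Cons b w)
    have "\<exists>m. b # w = replicate m False" if "\<not> b" "w = replicate m False" for m
      using that by (intro exI[of _ "Suc m"]) auto
    moreover have "\<exists>m v. b # w = replicate m False @ True # v" if "\<not> b" "w = replicate m False @ True # v" for m v
      using that by (intro exI[of _ "Suc m"]) auto
    moreover have "\<exists>m v. b # w = replicate m False @ True # v" if "b"
      using that by (intro exI[of _ 0]) auto
    ultimately show ?case using Cons by (cases b) force+
  qed auto
  then show thesis using that by blast
qed

locale bit_alphabet =
  fixes K :: nat and G :: "sym set"
  assumes Blank_in: "Blank \<in> G" and Bit_in: "\<And>b. Bit b \<in> G"
begin

abbreviation ex :: "prog \<Rightarrow> env \<Rightarrow> nat \<Rightarrow> env \<Rightarrow> bool" where
  "ex \<equiv> exec K G"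

lemma ex_mv: "J \<subseteq> {..<K} \<Longrightarrow> 1 \<le> n \<Longrightarrow> ex (mv J d) ts n (slide J (shift d) ts)"
  unfolding mv_def
  by (rule exec_Act) (auto simp: ok_def upd_def slide_def reads_def act_read split: if_splits)

lemma ex_scan:
  assumes "J \<subseteq> {..<K}" "j \<in> J"
    and "\<And>k. k < m \<Longrightarrow> snd (ts j) (fst (ts j) + shift d * int k) \<noteq> Blank"
    and "snd (ts j) (fst (ts j) + shift d * int m) = Blank"
  shows "ex (While (\<lambda>rd. rd j \<noteq> Blank) (mv J d)) ts (2 * m + 1) (slide J (shift d * int m) ts)"
  using assms(3,4)
proof (induction m arbitrary: ts)
  case 0
  then show ?case using exec.WhileF[of "\<lambda>rd. rd j \<noteq> Blank" ts 1] by (simp add: reads_def read_alt)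
next
  case (Suc m)
  let ?ts = "slide J (shift d) ts"
  have j: "snd (?ts j) = snd (ts j)" "fst (?ts j) = fst (ts j) + shift d"
    using assms(2) by (auto simp: slide_def)
  have 1: "ex (While (\<lambda>rd. rd j \<noteq> Blank) (mv J d)) ?ts (2 * m + 1) (slide J (shift d * int m) ?ts)"
  proof (rule Suc.IH)
    show "snd (?ts j) (fst (?ts j) + shift d * int k) \<noteq> Blank" if "k < m" for k
      using Suc.prems(1)[of "Suc k"] that by (simp add: j algebra_simps)
    show "snd (?ts j) (fst (?ts j) + shift d * int m) = Blank"
      using Suc.prems(2) by (simp add: j algebra_simps)
  qed
  have 2: "reads ts j \<noteq> Blank" using Suc.prems(1)[of 0] by (simp add: reads_def read_alt)
  show ?case
    using exec.WhileT[of "\<lambda>rd. rd j \<noteq> Blank" ts, OF 2 ex_mv[OF assms(1) order.refl] 1]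
    by (simp add: algebra_simps)
qed

lemma ex_rewind:
  assumes "J \<subseteq> {..<K}" "j \<in> J" "ts j = (int k, cells_of w)" "k \<le> length w" "2 * k + 5 \<le> n"
  shows "ex (rewind j J) ts n (slide J (- int k) ts)"
proof -
  let ?ts = "slide J (-1) ts"
  have j: "snd (?ts j) = cells_of w" "fst (?ts j) = int k - 1"
    using assms(2,3) by (auto simp: slide_def)
  have 1: "ex (While (\<lambda>rd. rd j \<noteq> Blank) (mv J Move_Left)) ?ts (2 * k + 1) (slide J (shift Move_Left * int k) ?ts)"
    using assms(1,2,4) by (intro ex_scan) (auto simp: j cells_of_def)
  show ?thesis
    unfolding rewind_def
    apply (rule exec_eq[OF exec.Seq[OF ex_mv[OF assms(1) order.refl] exec.Seq[OF _ ex_mv[OF assms(1) order.refl] order.refl] order.refl]])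
    using 1 assms(5) by auto
qed

lemma ex_copy:
  assumes "s < K" "J \<subseteq> {..<K}" "s \<notin> J" "ts s = (int p, cells_of u)" "p \<le> length u"
    and "\<And>i. i \<in> J \<Longrightarrow> ts i = wtape (off i) v" "2 * length u + 1 \<le> n"
  shows "ex (copy s J) ts n (\<lambda>i. if i = s then (int (length u), cells_of u)
    else if i \<in> J then wtape (off i) (v @ drop p u) else ts i)" (is "ex _ _ _ (?fin ts p v)")
proof -
  have "ex (copy s J) ts (2 * (length u - p) + 1) (?fin ts p v)"
    using assms(4-6)
  proof (induction "length u - p" arbitrary: p v ts)
    case 0
    have p: "p = length u" using 0 by simp
    have 1: "ts = ?fin ts p v" using 0 p by auto
    have "ex (copy s J) ts 1 ts"
      unfolding copy_def by (rule exec.WhileF) (auto simp: reads_def 0(2) p)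
    then show ?case by (rule exec_eq[OF _ 1]) simp
  next
    case (Suc m)
    have p: "p < length u" using Suc(2) by simp
    let ?ts = "\<lambda>i. if i = s then (int (Suc p), cells_of u) else if i \<in> J then wtape (off i) (v @ [u ! p]) else ts i"
    have rd: "reads ts s = Bit (u ! p)" using Suc p by (simp add: reads_def)
    have 1: "ex (Act (\<lambda>rd i. if i \<in> insert s J then Some (rd s, Move_Right) else None)) ts 1 ?ts"
    proof (rule exec_Act)
      show "ok K G (reads ts) (\<lambda>i. if i \<in> insert s J then Some (reads ts s, Move_Right) else None)"
        using assms(1,2) rd Bit_in by (auto simp: ok_def split: if_splits)
      have "(cells_of u)(int p := Bit (u ! p)) = cells_of u" using p by (auto simp: cells_of_def)
      then show "?ts = upd ts (\<lambda>i. if i \<in> insert s J then Some (reads ts s, Move_Right) else None)"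
        using Suc.prems assms(3) by (auto simp: upd_def rd fun_eq_iff)
    qed auto
    have 2: "ex (copy s J) ?ts (2 * (length u - Suc p) + 1) (?fin ?ts (Suc p) (v @ [u ! p]))"
      using assms(3) Suc(2) p by (intro Suc.hyps(1)) auto
    have 3: "?fin ?ts (Suc p) (v @ [u ! p]) = ?fin ts p v"
      using p by (auto simp: Cons_nth_drop_Suc)
    show ?case
      using exec.WhileT[OF _ 1 2[unfolded copy_def], of "2 * (length u - p) + 1"] rd p 3
      unfolding copy_def by simp
  qed
  then show ?thesis using assms(7) exec_mono by fastforce
qed

lemma ex_decr:
  assumes "j < K" "f < K" "j \<noteq> f" "s \<in> G" "ts j = (0, cells_of w)" "ts f = var a" "4 * length w + 12 \<le> n"
  shows "ex (decr j f s) ts n (ts(j := (0, cells_of (dec w)), f := var (if val w = 0 then s else a)))"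
proof -
  \<comment> \<open>Invariant of the borrow: \<open>k\<close> cells are flipped already and
    \<open>m\<close> zeros are still ahead. The condition on \<open>v\<close> guarantees that the
    loop stops in front of \<open>v\<close>.\<close>
  have loop: "ex (While (\<lambda>rd. rd j = Bit False) (Act (\<lambda>rd. [j \<mapsto> (Bit True, Move_Right)])))
      (ts(j := (int k, cells_of (replicate k True @ replicate m False @ v)))) (2 * m + 1)
      (ts(j := (int (k + m), cells_of (replicate (k + m) True @ v))))"
    if "v = [] \<or> hd v" for k m v
  proof (induction m arbitrary: k)
    case 0
    have "cells_of (replicate k True @ v) (int k) \<noteq> Bit False"
      using that by (cases v) (auto simp: cells_of_def nth_append)
    then show ?case by (auto intro!: exec.WhileF simp: reads_def)
  next
    case (Suc m)
    let ?ts = "ts(j := (int k, cells_of (replicate k True @ replicate (Suc m) False @ v)))"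
    have 1: "reads ?ts j = Bit False" by (simp add: reads_def cells_of_def nth_append)
    have u: "(replicate k True @ replicate (Suc m) False @ v)[k := True] = replicate (Suc k) True @ replicate m False @ v"
      by (induction k) auto
    have 2: "ex (Act (\<lambda>rd. [j \<mapsto> (Bit True, Move_Right)])) ?ts 1
       (ts(j := (int (Suc k), cells_of (replicate (Suc k) True @ replicate m False @ v))))"
      using assms(1) Bit_in u cells_of_update[of k "replicate k True @ replicate (Suc m) False @ v" True]
      by (intro exec_Act) (auto simp del: replicate_Suc)
    have 3: "ex (While (\<lambda>rd. rd j = Bit False) (Act (\<lambda>rd. [j \<mapsto> (Bit True, Move_Right)])))
      (ts(j := (int (Suc k), cells_of (replicate (Suc k) True @ replicate m False @ v)))) (2 * m + 1)
      (ts(j := (int (k + Suc m), cells_of (replicate (k + Suc m) True @ v))))"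
      by (rule exec_eq[OF Suc.IH]) (simp_all add: fun_upd_def)
    show ?case by (rule exec.WhileT[OF _ 2 3]) (use 1 in simp_all)
  qed
  have rw: "ex (rewind j {j}) (ts'(j := (int k, cells_of u))) n' (ts'(j := (0, cells_of u)))"
    if "k \<le> length u" "2 * k + 5 \<le> n'" for ts' k u n'
    using ex_rewind[of "{j}" j "ts'(j := (int k, cells_of u))" k u n'] that assms(1)
    by (auto simp: slide_def fun_upd_def if_distrib cong: if_cong)
  let ?c = "Cond (\<lambda>rd. rd j = Blank) (Act (\<lambda>rd. [f \<mapsto> (s, Stay)])) (Act (\<lambda>rd. [j \<mapsto> (Bit False, Stay)]))"
  show ?thesis
  proof (cases w rule: word_cases)
    case (1 m)
    let ?t = "ts(j := (int m, cells_of (replicate m True)))"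
    have a: "ex (While (\<lambda>rd. rd j = Bit False) (Act (\<lambda>rd. [j \<mapsto> (Bit True, Move_Right)]))) ts (2 * m + 1) ?t"
      using loop[of "[]" 0 m] 1 assms(5) by (simp add: fun_upd_idem)
    have b: "ex ?c ?t 2 (?t(f := var s))"
      using assms by (intro exec.CondT[OF _ exec_Act[OF _ _ order.refl]]) (auto simp: reads_def)
    have "ex (decr j f s) ts (2 * m + 1 + (2 + (2 * m + 5) + 1) + 1) (ts(f := var s, j := (0, cells_of (replicate m True))))"
      unfolding decr_def
      using b rw[of m "replicate m True" "2 * m + 5" "ts(f := var s)"] assms(3)
      by (intro exec.Seq[OF a exec.Seq[of _ _ _ _ 2 "?t(f := var s)" _ "2 * m + 5"]]) (auto simp: fun_upd_twist)
    then show ?thesis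
      by (rule exec_eq) (use 1 assms in \<open>auto simp: dec_replicate_False fun_upd_twist\<close>)
  next
    case (2 m v)
    let ?t = "ts(j := (int m, cells_of (replicate m True @ True # v)))"
    let ?t' = "ts(j := (int m, cells_of (replicate m True @ False # v)))"
    have a: "ex (While (\<lambda>rd. rd j = Bit False) (Act (\<lambda>rd. [j \<mapsto> (Bit True, Move_Right)]))) ts (2 * m + 1) ?t"
      using loop[of "True # v" 0 m] 2 assms(5) by (simp add: fun_upd_idem)
    have b: "ex ?c ?t 2 ?t'"
      using assms Bit_in
      by (intro exec.CondF[OF _ exec_Act[OF _ _ order.refl]])
        (auto simp: reads_def cells_of_update list_update_append)
    have "ex (decr j f s) ts (2 * m + 1 + (2 + (2 * m + 5) + 1) + 1) (ts(j := (0, cells_of (replicate m True @ False # v))))"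
      unfolding decr_def
      using b rw[of m "replicate m True @ False # v" "2 * m + 5" "ts"]
      by (intro exec.Seq[OF a exec.Seq[of _ _ _ _ 2 "?t'" _ "2 * m + 5"]]) auto
    then show ?thesis
      by (rule exec_eq) (use 2 assms in \<open>auto simp: dec_replicate_False_True\<close>)
  qed
qed

end

section \<open>Simulating and erasing\<close>

definition valid :: "nat tm \<Rightarrow> nat config \<Rightarrow> bool" where
  "valid M cf \<longleftrightarrow> fst cf \<in> states M \<and> length (snd cf) = tapes M \<and>
     (\<forall>t\<in>set (snd cf). range (snd t) \<subseteq> alphabet M)"

lemma valid_init: "wf_tm M \<Longrightarrow> valid M (init M w)"
  by (auto simp: valid_def init_def wf_tm_def cells_of_def) (metis (full_types))

lemma wf_tm_delta:
  assumes "wf_tm M" "q \<in> states M" "length ss = tapes M" "set ss \<subseteq> alphabet M" "delta M q ss = (q', as)"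
  shows "q' \<in> states M" "length as = tapes M" "fst ` set as \<subseteq> alphabet M"
proof -
  have "case delta M q ss of (q', as) \<Rightarrow>
      q' \<in> states M \<and> length as = tapes M \<and> fst ` set as \<subseteq> alphabet M"
    using assms(1)[unfolded wf_tm_def, THEN conjunct2, THEN conjunct2, THEN conjunct2, THEN conjunct2,
        THEN conjunct2, THEN conjunct2, rule_format, OF assms(2) conjI[OF assms(3,4)]] .
  then show "q' \<in> states M" "length as = tapes M" "fst ` set as \<subseteq> alphabet M"
    using assms(5) by simp_all
qed

lemma valid_step:
  assumes "wf_tm M" "valid M cf"
  shows "valid M (step M cf)"
proof (cases "halted M cf")
  case False
  obtain q' as where d: "delta M (fst cf) (map read (snd cf)) = (q', as)" by force
  have "set (map read (snd cf)) \<subseteq> alphabet M"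
    using assms(2) by (fastforce simp: valid_def read_alt)
  then have 1: "q' \<in> states M" "length as = tapes M" "fst ` set as \<subseteq> alphabet M"
    using wf_tm_delta[OF assms(1) _ _ _ d] assms(2) by (auto simp: valid_def)
  have "range (snd (act t a)) \<subseteq> alphabet M" if "(t, a) \<in> set (zip (snd cf) as)" for t a
  proof -
    have "t \<in> set (snd cf)" "a \<in> set as" using that by (auto dest: set_zip_leftD set_zip_rightD)
    then have "range (snd t) \<subseteq> alphabet M" "fst a \<in> alphabet M"
      using assms(2) 1(3) by (auto simp: valid_def)
    then show ?thesis by (cases t; cases a) auto
  qed
  then have "\<forall>t\<in>set (map2 act (snd cf) as). range (snd t) \<subseteq> alphabet M"
    by (metis (no_types, lifting) imageE list.set_map split_conv surj_pair)
  then show ?thesis using False d 1 assms(2) by (simp add: step_def valid_def)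
qed (use assms in \<open>simp add: step_def\<close>)

lemma step_halted [simp]: "halted M cf \<Longrightarrow> step M cf = cf"
  by (simp add: step_def)

lemma run_stable: "t \<le> t' \<Longrightarrow> halted M (run M w t) \<Longrightarrow> run M w t' = run M w t"
  by (induction rule: dec_induct) (simp_all add: run_def)

lemma accepts_iff_halted:
  assumes "halted M (run M w t)"
  shows "accepts M w \<longleftrightarrow> fst (run M w t) = acc M"
proof
  assume "accepts M w"
  then obtain s where s: "fst (run M w s) = acc M" by (auto simp: accepts_def)
  then have "halted M (run M w s)" by (simp add: halted_def)
  then show "fst (run M w t) = acc M"
    using s assms run_stable[of s t M w] run_stable[of t s M w] by (cases "s \<le> t") auto
qed (auto simp: accepts_def)

section \<open>Padding the blanks among the visited cells\<close>

definition fresh :: "nat tm \<Rightarrow> sym" where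
  "fresh M = Work (SOME n. Work n \<notin> alphabet M)"

lemma fresh: "wf_tm M \<Longrightarrow> fresh M \<notin> alphabet M"
proof -
  assume "wf_tm M"
  then have "finite (Work -` alphabet M)" by (auto simp: wf_tm_def intro!: finite_vimageI inj_onI)
  then have "\<exists>n. n \<notin> Work -` alphabet M" using ex_new_if_finite infinite_UNIV_nat by blast
  then have "\<exists>n. Work n \<notin> alphabet M" by simp
  then show ?thesis unfolding fresh_def by (rule someI_ex)
qed

lemma fresh_neq [simp]: "fresh M \<noteq> Blank" "fresh M \<noteq> Bit b"
  by (auto simp: fresh_def)

definition mark :: "sym \<Rightarrow> sym \<Rightarrow> sym" where
  "mark m s = (if s = Blank then m else s)"

definition unmark :: "sym \<Rightarrow> sym \<Rightarrow> sym" where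
  "unmark m s = (if s = m then Blank else s)"

text \<open>The real tape is the virtual one translated by \<open>off\<close>, except that the blank cells among the
  at most \<open>W\<close> visited cells carry the symbol \<open>m\<close>. So the nonblank cells of the real tape form an
  interval, which makes it possible to erase the tape later.\<close>

definition marked :: "sym \<Rightarrow> int \<Rightarrow> nat \<Rightarrow> tape \<Rightarrow> tape \<Rightarrow> bool" where
  "marked m off W vt rt \<longleftrightarrow> fst rt = fst vt + off \<and>
     (\<exists>l r. l \<le> r \<and> r - l \<le> int W \<and> l - 1 \<le> fst vt \<and> fst vt \<le> r \<and>
       (\<forall>z. snd rt (z + off) = (if l \<le> z \<and> z < r then mark m (snd vt z) else Blank)) \<and>
       (\<forall>z. \<not> (l \<le> z \<and> z < r) \<longrightarrow> snd vt z = Blank))"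

lemma marked_read:
  "marked m off W vt rt \<Longrightarrow> read vt \<noteq> m \<Longrightarrow> m \<noteq> Blank \<Longrightarrow> unmark m (read rt) = read vt"
proof -
  assume m: "marked m off W vt rt" "read vt \<noteq> m" "m \<noteq> Blank"
  then obtain l r where "snd rt (fst vt + off) = (if l \<le> fst vt \<and> fst vt < r then mark m (snd vt (fst vt)) else Blank)"
    "\<not> (l \<le> fst vt \<and> fst vt < r) \<longrightarrow> snd vt (fst vt) = Blank" "fst rt = fst vt + off"
    unfolding marked_def by blast
  then show ?thesis using m(2,3) by (auto simp: read_alt mark_def unmark_def split: if_splits)
qed

text \<open>The head is at most one cell outside the interval, so the written cell lies inside it or
  extends it by one, and the new head position is again at most one cell outside.\<close>

lemma marked_act:
  assumes "marked m off W vt rt"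
  shows "marked m off (Suc W) (act vt (s, d)) (act rt (mark m s, d))"
proof -
  obtain h c where vt: "vt = (h, c)" by force
  obtain h' c' where rt: "rt = (h', c')" by force
  obtain l r where lr: "h' = h + off" "l \<le> r" "r - l \<le> int W" "l - 1 \<le> h" "h \<le> r"
    "\<And>z. c' (z + off) = (if l \<le> z \<and> z < r then mark m (c z) else Blank)"
    "\<And>z. \<not> (l \<le> z \<and> z < r) \<Longrightarrow> c z = Blank"
    using assms by (auto simp: marked_def vt rt)
  have "\<bar>shift d\<bar> \<le> 1" by (cases d) auto
  note d = this
  show ?thesis
    unfolding marked_def vt rt act.simps fst_conv snd_conv
    by (rule conjI, use lr in simp, rule exI[of _ "min l h"], rule exI[of _ "max r (h + 1)"]) (use lr d in \<open>auto simp: min_def max_def\<close>)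
qed

lemma marked_blank: "marked m off W blank_tape (wtape off [])"
  by (auto simp: marked_def wtape_Nil intro!: exI[of _ 0])

lemma marked_input: "length w \<le> W \<Longrightarrow> marked m off W (0, cells_of w) (off, \<lambda>z. cells_of w (z - off))"
  unfolding marked_def
  by (rule conjI, simp, rule exI[of _ 0], rule exI[of _ "int (length w)"]) (auto simp: cells_of_def mark_def)

text \<open>States are natural numbers, so \<open>Work q\<close> on tape \<open>v\<close> can hold
  the state \<open>q\<close>; that tape is separate, hence a coincidence with work symbols of
  \<open>M\<close> is harmless. One action performs one step of \<open>M\<close>: reading removes
  the padding, writing restores it.\<close>

definition sim_act :: "nat tm \<Rightarrow> nat \<Rightarrow> nat \<Rightarrow> (nat \<Rightarrow> sym) \<Rightarrow> nat \<rightharpoonup> sym \<times> dir" where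
  "sim_act M v b rd = (case rd v of
     Work q \<Rightarrow> (case delta M q (map (\<lambda>i. unmark (fresh M) (rd (b + i))) [0..<tapes M]) of (q', as) \<Rightarrow>
       (\<lambda>i. if i = v then Some (Work q', Stay)
            else if b \<le> i \<and> i < b + tapes M
              then Some (mark (fresh M) (fst (as ! (i - b))), snd (as ! (i - b)))
            else None))
   | _ \<Rightarrow> Map.empty)"

definition sim :: "nat tm \<Rightarrow> nat \<Rightarrow> nat \<Rightarrow> prog" where
  "sim M v b = While (\<lambda>rd. rd v \<notin> {Work (acc M), Work (rej M)}) (Act (sim_act M v b))"

definition simulates :: "nat tm \<Rightarrow> nat \<Rightarrow> nat \<Rightarrow> (nat \<Rightarrow> int) \<Rightarrow> nat \<Rightarrow> nat config \<Rightarrow> env \<Rightarrow> bool" where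
  "simulates M v b off W cf ts \<longleftrightarrow> ts v = var (Work (fst cf)) \<and>
     (\<forall>i<tapes M. marked (fresh M) (off i) W (snd cf ! i) (ts (b + i)))"

definition tm_symbols :: "nat tm \<Rightarrow> sym set" where
  "tm_symbols M = insert (fresh M) (alphabet M \<union> Work ` states M)"

lemma finite_tm_symbols: "wf_tm M \<Longrightarrow> finite (tm_symbols M)"
  by (simp add: tm_symbols_def wf_tm_def)

text \<open>The head may stand next to the used interval or at a gap-free inner cell; putting a bit
  under it makes it part of the interval in every case. From the right end, erasing leftwards then
  meets every used cell before the first blank.\<close>

definition erase :: "nat \<Rightarrow> prog" where
  "erase i = Act (\<lambda>rd. [i \<mapsto> (Bit True, Stay)]) ;; While (\<lambda>rd. rd i \<noteq> Blank) (mv {i} Move_Right) ;;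
     mv {i} Move_Left ;; While (\<lambda>rd. rd i \<noteq> Blank) (Act (\<lambda>rd. [i \<mapsto> (Blank, Move_Left)]))"

definition skip :: prog where
  "skip = Act (\<lambda>_. Map.empty)"

fun erase_block :: "nat \<Rightarrow> nat \<Rightarrow> prog" where
  "erase_block b 0 = skip"
| "erase_block b (Suc k) = erase_block b k ;; erase (b + k)"

context bit_alphabet
begin

lemma ex_skip: "1 \<le> n \<Longrightarrow> ex skip ts n ts"
  unfolding skip_def by (rule exec_Act) auto

lemma ex_sim_act:
  assumes M: "wf_tm M" "valid M cf" "\<not> halted M cf"
    and tapes: "v < K" "b + tapes M \<le> K" "v < b" "tm_symbols M \<subseteq> G"
    and sim: "simulates M v b off W cf ts"
  shows "\<exists>ts'. ex (Act (sim_act M v b)) ts 1 ts' \<and> simulates M v b off (Suc W) (step M cf) ts' \<and>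
    (\<forall>i. i \<noteq> v \<and> \<not> (b \<le> i \<and> i < b + tapes M) \<longrightarrow> ts' i = ts i)"
proof -
  obtain q' as where d: "delta M (fst cf) (map read (snd cf)) = (q', as)" by force
  have len: "length (snd cf) = tapes M" using M by (simp add: valid_def)
  have al: "read t \<in> alphabet M" if "t \<in> set (snd cf)" for t
    using that M(2) by (auto simp: valid_def read_alt)
  have rd: "map (\<lambda>i. unmark (fresh M) (reads ts (b + i))) [0..<tapes M] = map read (snd cf)"
  proof (rule nth_equalityI, goal_cases)
    case (2 i)
    then have i: "i < tapes M" by simp
    then have "read (snd cf ! i) \<noteq> fresh M" using al len fresh[OF M(1)] by (metis nth_mem)
    then show ?case using i len sim marked_read[of "fresh M" "off i" W "snd cf ! i" "ts (b + i)"]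
      by (simp add: simulates_def reads_def)
  qed (simp add: len)
  have "set (map read (snd cf)) \<subseteq> alphabet M" using al by auto
  then have wf: "q' \<in> states M" "length as = tapes M" "fst ` set as \<subseteq> alphabet M"
    using wf_tm_delta[OF M(1) _ _ _ d] M(2) by (auto simp: valid_def)
  have v: "reads ts v = Work (fst cf)" using sim by (simp add: simulates_def reads_def)
  let ?m = "\<lambda>i. if i = v then Some (Work q', Stay)
            else if b \<le> i \<and> i < b + tapes M
              then Some (mark (fresh M) (fst (as ! (i - b))), snd (as ! (i - b)))
            else None"
  have m: "sim_act M v b (reads ts) = ?m" unfolding sim_act_def v rd by (simp add: d)
  have "fst (as ! (i - b)) \<in> alphabet M" if "b \<le> i" "i < b + tapes M" for i
    using that wf(2,3) by (auto intro: nth_mem)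
  then have "ok K G (reads ts) ?m"
    using tapes wf by (auto simp: ok_def mark_def tm_symbols_def split: if_splits)
  then have 1: "ex (Act (sim_act M v b)) ts 1 (upd ts ?m)"
    by (intro exec_Act) (simp_all add: m)
  have st: "step M cf = (q', map2 act (snd cf) as)" using M(3) d by (simp add: step_def)
  have "marked (fresh M) (off i) (Suc W) (snd (step M cf) ! i) (upd ts ?m (b + i))" if "i < tapes M" for i
  proof -
    have "marked (fresh M) (off i) W (snd cf ! i) (ts (b + i))" using sim that by (simp add: simulates_def)
    from marked_act[OF this, of "fst (as ! i)" "snd (as ! i)"]
    show ?thesis using that tapes len wf st by (simp add: upd_def)
  qed
  moreover have "upd ts ?m v = var (Work q')" using sim by (simp add: upd_def simulates_def)
  ultimately have "simulates M v b off (Suc W) (step M cf) (upd ts ?m)"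
    by (simp add: simulates_def st)
  then show ?thesis using 1 by (intro exI[of _ "upd ts ?m"]) (auto simp: upd_def)
qed

lemma ex_sim:
  assumes M: "wf_tm M" "valid M cf" "halted M ((step M ^^ t) cf)"
    and tapes: "v < K" "b + tapes M \<le> K" "v < b" "tm_symbols M \<subseteq> G"
    and sim: "simulates M v b off W cf ts"
  shows "\<exists>ts'. ex (sim M v b) ts (2 * t + 1) ts' \<and> simulates M v b off (W + t) ((step M ^^ t) cf) ts' \<and>
    (\<forall>i. i \<noteq> v \<and> \<not> (b \<le> i \<and> i < b + tapes M) \<longrightarrow> ts' i = ts i)"
  using M(2,3) sim
proof (induction t arbitrary: cf W ts)
  case 0
  then have "ex (sim M v b) ts 1 ts"
    unfolding sim_def by (intro exec.WhileF) (auto simp: simulates_def reads_def halted_def)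
  then show ?case using 0 by auto
next
  case (Suc t)
  show ?case
  proof (cases "halted M cf")
    \<comment> \<open>\<open>M\<close> has halted already: the loop stops at once, and only the
      bounds on time and space are loosened.\<close>
    case True
    then have "ex (sim M v b) ts (2 * Suc t + 1) ts"
      unfolding sim_def using Suc.prems by (intro exec.WhileF) (auto simp: simulates_def reads_def halted_def)
    moreover have "(step M ^^ n) cf = cf" for n using True by (induction n) auto
    moreover have "marked (fresh M) o' (W + Suc t) vt rt" if "marked (fresh M) o' W vt rt" for o' vt rt
      using that unfolding marked_def by fastforce
    then have "simulates M v b off (W + Suc t) cf ts"
      using Suc.prems(3) by (simp add: simulates_def)
    ultimately show ?thesis by (intro exI[of _ ts]) (simp del: funpow.simps)
  next
    case False
    obtain ts1 where ts1: "ex (Act (sim_act M v b)) ts 1 ts1" "simulates M v b off (Suc W) (step M cf) ts1"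
      "\<And>i. i \<noteq> v \<and> \<not> (b \<le> i \<and> i < b + tapes M) \<Longrightarrow> ts1 i = ts i"
      using ex_sim_act[OF M(1) Suc.prems(1) False tapes Suc.prems(3)] by blast
    have e: "(step M ^^ Suc t) cf = (step M ^^ t) (step M cf)" by (simp add: funpow_swap1)
    obtain ts2 where ts2: "ex (sim M v b) ts1 (2 * t + 1) ts2"
      "simulates M v b off (Suc W + t) ((step M ^^ t) (step M cf)) ts2"
      "\<And>i. i \<noteq> v \<and> \<not> (b \<le> i \<and> i < b + tapes M) \<Longrightarrow> ts2 i = ts1 i"
      using Suc.IH[OF valid_step[OF M(1) Suc.prems(1)] _ ts1(2)] Suc.prems(2) e by force
    have "ex (sim M v b) ts (2 * Suc t + 1) ts2"
      unfolding sim_def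
      by (rule exec.WhileT[OF _ ts1(1) ts2(1)[unfolded sim_def]])
        (use False Suc.prems(3) in \<open>auto simp: simulates_def reads_def halted_def\<close>)
    then show ?thesis using ts2 ts1(3) by (auto simp: e simp del: funpow.simps)
  qed
qed

lemma ex_erase:
  assumes "i < K" "marked m off W vt (ts i)" "m \<noteq> Blank" "4 * W + 12 \<le> n"
  shows "\<exists>off'. ex (erase i) ts n (ts(i := wtape off' []))"
proof -
  obtain h c where t: "ts i = (h, c)" by force
  obtain h' c' where vt: "vt = (h', c')" by force
  obtain l r where lr: "h = h' + off" "l \<le> r" "r - l \<le> int W" "l - 1 \<le> h'" "h' \<le> r"
    "\<And>z. c (z + off) = (if l \<le> z \<and> z < r then mark m (c' z) else Blank)"
    using assms(2) by (auto simp: marked_def t vt)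
  \<comment> \<open>The used interval after the bit has been written under the head, in real
    coordinates. It has at most one cell more than before.\<close>
  define L R where "L = min (l + off) h" and "R = max (r + off) (h + 1)"
  have LR: "L \<le> h" "h < R" "R - L \<le> int W + 1" using lr by (auto simp: L_def R_def)
  let ?c = "c(h := Bit True)"
  have c: "?c z \<noteq> Blank \<longleftrightarrow> L \<le> z \<and> z < R" for z
    using lr(6)[of "z - off"] lr assms(3) by (auto simp: L_def R_def mark_def)
  have 1: "ex (Act (\<lambda>rd. [i \<mapsto> (Bit True, Stay)])) ts 1 (ts(i := (h, ?c)))"
    using assms(1) Bit_in t by (intro exec_Act) auto
  have sl: "slide {i} k (ts(i := (a, f))) = ts(i := (a + k, f))" for k a f
    by (auto simp: slide_def)
  have 2: "ex (While (\<lambda>rd. rd i \<noteq> Blank) (mv {i} Move_Right)) (ts(i := (h, ?c))) (2 * nat (R - h) + 1) (ts(i := (R, ?c)))"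
  proof (rule exec_eq[OF ex_scan[where m = "nat (R - h)"]])
    show "slide {i} (shift Move_Right * int (nat (R - h))) (ts(i := (h, ?c))) = ts(i := (R, ?c))"
      using LR by (simp add: sl)
    show "snd ((ts(i := (h, ?c))) i) (fst ((ts(i := (h, ?c))) i) + shift Move_Right * int k) \<noteq> Blank"
      if "k < nat (R - h)" for k
      using c[of "h + int k"] that LR by simp
    show "snd ((ts(i := (h, ?c))) i) (fst ((ts(i := (h, ?c))) i) + shift Move_Right * int (nat (R - h))) = Blank"
      using c[of R] LR by simp
  qed (use assms(1) in auto)
  have 3: "ex (mv {i} Move_Left) (ts(i := (R, ?c))) 1 (ts(i := (R - 1, ?c)))"
    using ex_mv[of "{i}" 1 Move_Left "ts(i := (R, ?c))"] assms(1) by (simp add: sl)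
  have 4: "ex (While (\<lambda>rd. rd i \<noteq> Blank) (Act (\<lambda>rd. [i \<mapsto> (Blank, Move_Left)])))
     (ts(i := (L + int k - 1, f))) (2 * k + 1) (ts(i := (L - 1, \<lambda>_. Blank)))"
    if "\<And>z. f z \<noteq> Blank \<longleftrightarrow> L \<le> z \<and> z < L + int k" for k f
    using that
  proof (induction k arbitrary: f)
    case 0
    have f: "f = (\<lambda>_. Blank)"
      using 0 by (intro ext) (metis add.right_neutral int_ops(1) not_le)
    show ?case by (rule exec_eq[OF exec.WhileF[OF _ order.refl]]) (simp_all add: f reads_def)
  next
    case (Suc k)
    have s: "ex (Act (\<lambda>rd. [i \<mapsto> (Blank, Move_Left)])) (ts(i := (L + int (Suc k) - 1, f))) 1
       (ts(i := (L + int k - 1, f(L + int k := Blank))))"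
      using assms(1) Blank_in by (intro exec_Act) auto
    have I: "ex (While (\<lambda>rd. rd i \<noteq> Blank) (Act (\<lambda>rd. [i \<mapsto> (Blank, Move_Left)])))
     (ts(i := (L + int k - 1, f(L + int k := Blank)))) (2 * k + 1) (ts(i := (L - 1, \<lambda>_. Blank)))"
    proof (rule Suc.IH)
      show "(f(L + int k := Blank)) z \<noteq> Blank \<longleftrightarrow> L \<le> z \<and> z < L + int k" for z
        using Suc.prems[of z] by auto
    qed
    show ?case by (rule exec.WhileT[OF _ s I]) (use Suc.prems[of "L + int k"] in \<open>simp_all add: reads_def\<close>)
  qed
  have 5: "ex (While (\<lambda>rd. rd i \<noteq> Blank) (Act (\<lambda>rd. [i \<mapsto> (Blank, Move_Left)])))
     (ts(i := (R - 1, ?c))) (2 * nat (R - L) + 1) (ts(i := wtape (L - 1) []))"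
    using 4[of ?c "nat (R - L)"] c LR by (simp add: wtape_Nil del: fun_upd_apply)
  have "ex (erase i) ts n (ts(i := wtape (L - 1) []))"
    unfolding erase_def
    by (rule exec.Seq[OF 1 exec.Seq[OF 2 exec.Seq[OF 3 5 order.refl] order.refl]]) (use assms(4) LR in linarith)
  then show ?thesis by blast
qed

lemma ex_erase_block:
  assumes "b + k \<le> K" "\<And>i. i < k \<Longrightarrow> marked m (off i) W (vt i) (ts (b + i))" "m \<noteq> Blank"
  shows "\<exists>off' ts'. ex (erase_block b k) ts (k * (4 * W + 13) + 1) ts' \<and>
    (\<forall>i<k. ts' (b + i) = wtape (off' i) []) \<and> (\<forall>i. \<not> (b \<le> i \<and> i < b + k) \<longrightarrow> ts' i = ts i)"
  using assms(1,2)
proof (induction k)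
  case 0
  then show ?case using ex_skip[of 1 ts] by auto
next
  case (Suc k)
  then obtain off' ts' where 1: "ex (erase_block b k) ts (k * (4 * W + 13) + 1) ts'"
    "\<And>i. i < k \<Longrightarrow> ts' (b + i) = wtape (off' i) []" "\<And>i. \<not> (b \<le> i \<and> i < b + k) \<Longrightarrow> ts' i = ts i"
    by (metis Suc_leD add_Suc_right less_Suc_eq)
  have "marked m (off k) W (vt k) (ts' (b + k))" using Suc.prems(2)[of k] 1(3)[of "b + k"] by simp
  then obtain a where a: "ex (erase (b + k)) ts' (4 * W + 12) (ts'(b + k := wtape a []))"
    using ex_erase[of "b + k" m "off k" W "vt k" ts'] Suc.prems assms(3) by auto
  have "ex (erase_block b (Suc k)) ts (Suc k * (4 * W + 13) + 1) (ts'(b + k := wtape a []))"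
    using exec.Seq[OF 1(1) a] by simp
  moreover have "(ts'(b + k := wtape a [])) (b + i) = wtape ((off'(k := a)) i) []" if "i < Suc k" for i
    using that 1(2) by (auto simp: less_Suc_eq)
  moreover have "(ts'(b + k := wtape a [])) i = ts i" if "\<not> (b \<le> i \<and> i < b + Suc k)" for i
    using that 1(3)[of i] by auto
  ultimately show ?case by blast
qed

end

section \<open>The least word of each length\<close>

text \<open>Rejection is explicit, since a simulation can only wait for one of the two halting
  states, and the caller then reads off which one was reached.\<close>

definition decides_in :: "(nat \<Rightarrow> nat) \<Rightarrow> nat tm \<Rightarrow> language \<Rightarrow> bool" where
  "decides_in T M L \<longleftrightarrow> wf_tm M \<and>
     (\<forall>w. \<exists>t\<le>T (length w). fst (run M w t) = (if w \<in> L then acc M else rej M))"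

lemma class_P_decides_in:
  assumes "L \<in> class_P"
  obtains M p where "decides_in (poly p) M L" "poly_time_tm M" "L = {w. accepts M w}"
proof -
  obtain M :: "nat tm" where M: "poly_time_tm M" "L = {w. accepts M w}"
    using assms by (auto simp: class_P_def)
  obtain p where p: "wf_tm M" "\<And>w. \<exists>t\<le>poly p (length w). halted M (run M w t)"
    using M(1) by (auto simp: poly_time_tm_def)
  have "fst (run M w t) = (if w \<in> L then acc M else rej M)" if "halted M (run M w t)" for w t
    using accepts_iff_halted[OF that] that M(2) by (auto simp: halted_def)
  then have "decides_in (poly p) M L" using p unfolding decides_in_def by meson
  then show thesis using that M by blast
qed

section \<open>Words of equal length, ordered by their binary value\<close>

lemma val_less: "val w < 2 ^ length w"
  by (induction w) auto

lemma val_inj: "length x = length y \<Longrightarrow> val x = val y \<Longrightarrow> x = y"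
proof (induction x y rule: list_induct2)
  case (Cons a x b y)
  then have "of_bool a + 2 * val x = of_bool b + 2 * val y" by simp
  then have "a = b \<and> val x = val y" by (cases a; cases b; simp; presburger)
  then show ?case using Cons by simp
qed simp

definition first :: "language \<Rightarrow> language" where
  "first L = {x \<in> L. \<forall>y. length y = length x \<and> val y < val x \<longrightarrow> y \<notin> L}"

definition simulate :: "nat tm \<Rightarrow> nat \<Rightarrow> nat \<Rightarrow> prog" where
  "simulate M v b = Act (\<lambda>_. [v \<mapsto> (Work (start M), Stay)]) ;; sim M v b"

text \<open>Tape 0 holds the candidate word, tape 2 the state of \<open>M\<close>, and the tapes of
  \<open>M\<close> start at 3. The flag \<open>Bit True\<close> is set before \<open>decr\<close>
  runs, so that an underflow, which means that no smaller word is left, can replace it by the final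
  \<open>Work 0\<close>.\<close>

definition first_body :: "nat tm \<Rightarrow> prog" where
  "first_body M =
     copy 0 {3} ;; rewind 0 {0, 3} ;; simulate M 2 3 ;;
     Cond (\<lambda>rd. (rd 2 = Work (acc M)) = (rd 1 = Blank))
       (Act (\<lambda>_. [1 \<mapsto> (Bit True, Stay)]) ;; erase_block 3 (tapes M) ;; decr 0 1 (Work 0))
       (Act (\<lambda>_. [1 \<mapsto> (Bit False, Stay)]))"

text \<open>Tape 1 holds a blank in the first round, in which the input itself has to be accepted,
  \<open>Bit True\<close> in the later rounds, in which the smaller words have to be rejected, and
  finally the answer.\<close>

definition first_prog :: "nat tm \<Rightarrow> prog" where
  "first_prog M = While (\<lambda>rd. rd 1 \<in> {Blank, Bit True}) (first_body M)"

context bit_alphabet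
begin

text \<open>Turing machines do not notice a translation of their tapes, hence one offset per tape.
  Afterwards each tape is only claimed to be the padded image of some virtual tape, which is exactly
  what erasing it requires.\<close>

lemma ex_simulate:
  assumes M: "wf_tm M" "fst (run M w t) \<in> {acc M, rej M}"
    and tapes: "v < K" "b + tapes M \<le> K" "v < b" "tm_symbols M \<subseteq> G"
    and ts: "ts v = var s" "ts b = (off 0, \<lambda>z. cells_of w (z - off 0))"
      "\<And>i. 0 < i \<Longrightarrow> i < tapes M \<Longrightarrow> ts (b + i) = wtape (off i) []"
  shows "\<exists>ts'. ex (simulate M v b) ts (2 * t + 3) ts' \<and> ts' v = var (Work (fst (run M w t))) \<and>
    (\<forall>i<tapes M. \<exists>vt. marked (fresh M) (off i) (length w + t) vt (ts' (b + i))) \<and>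
    (\<forall>i. i \<noteq> v \<and> \<not> (b \<le> i \<and> i < b + tapes M) \<longrightarrow> ts' i = ts i)"
proof -
  have k: "1 \<le> tapes M" "start M \<in> states M" using M(1) by (auto simp: wf_tm_def)
  let ?ts = "ts(v := var (Work (start M)))"
  have 1: "ex (Act (\<lambda>_. [v \<mapsto> (Work (start M), Stay)])) ts 1 ?ts"
    using tapes k ts(1) by (intro exec_Act) (auto simp: tm_symbols_def)
  have 2: "simulates M v b off (length w) (init M w) ?ts"
  proof -
    have "marked (fresh M) (off i) (length w) (snd (init M w) ! i) (?ts (b + i))" if "i < tapes M" for i
    proof (cases i)
      case 0
      then show ?thesis using ts(2) tapes(3) by (simp add: init_def marked_input)
    next
      case (Suc j)
      then have "snd (init M w) ! i = blank_tape" using that by (simp add: init_def)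
      then show ?thesis using ts(3)[of i] Suc that tapes(3) by (simp add: marked_blank)
    qed
    then show ?thesis by (simp add: simulates_def) (simp add: init_def)
  qed
  have "halted M ((step M ^^ t) (init M w))" using M(2) by (simp add: halted_def run_def)
  from ex_sim[OF M(1) valid_init[OF M(1)] this tapes 2]
  obtain ts' where ts': "ex (sim M v b) ?ts (2 * t + 1) ts'"
    "simulates M v b off (length w + t) (run M w t) ts'"
    "\<And>i. i \<noteq> v \<and> \<not> (b \<le> i \<and> i < b + tapes M) \<Longrightarrow> ts' i = ?ts i"
    unfolding run_def by blast
  have "ex (simulate M v b) ts (2 * t + 3) ts'"
    unfolding simulate_def by (rule exec.Seq[OF 1 ts'(1)]) simp
  moreover have "ts' v = var (Work (fst (run M w t)))"
    "\<forall>i<tapes M. \<exists>vt. marked (fresh M) (off i) (length w + t) vt (ts' (b + i))"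
    using ts'(2) unfolding simulates_def by blast+
  ultimately show ?thesis using ts'(3) by (intro exI[of _ ts']) simp
qed

definition first_inv :: "nat tm \<Rightarrow> word \<Rightarrow> sym \<Rightarrow> env \<Rightarrow> bool" where
  "first_inv M y f ts \<longleftrightarrow> ts 0 = (0, cells_of y) \<and> ts 1 = var f \<and> (\<exists>s. ts 2 = var s) \<and>
     (\<forall>i<tapes M. \<exists>off. ts (3 + i) = wtape off [])"

text \<open>A crude bound for one round including the loop test; the body alone is therefore given
  one step less.\<close>

definition first_time :: "nat tm \<Rightarrow> nat \<Rightarrow> nat" where
  "first_time M n = (tapes M + 2) * (4 * n + 40)"

lemma ex_first_body:
  assumes M: "wf_tm M" "fst (run M y t) = (if y \<in> L then acc M else rej M)"
    and G: "tm_symbols M \<subseteq> G" "Work 0 \<in> G" and K: "K = 3 + tapes M"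
    and inv: "first_inv M y f ts"
  shows "\<exists>ts'. ex (first_body M) ts (first_time M (length y + t) - 1) ts' \<and>
    (if (y \<in> L) = (f = Blank)
     then first_inv M (dec y) (if val y = 0 then Work 0 else Bit True) ts'
     else ts' 1 = var (Bit False))"
proof -
  have k: "1 \<le> tapes M" "acc M \<noteq> rej M" using M(1) by (auto simp: wf_tm_def)
  obtain off where off: "\<And>i. i < tapes M \<Longrightarrow> ts (3 + i) = wtape (off i) []"
    using inv unfolding first_inv_def by metis
  obtain s where ts: "ts 0 = (0, cells_of y)" "ts 1 = var f" "ts 2 = var s"
    using inv unfolding first_inv_def by auto
  let ?n = "length y"
  let ?t1 = "ts(0 := (int ?n, cells_of y), 3 := wtape (off 0) y)"
  have "ex (copy 0 {3}) ts (2 * ?n + 1) (\<lambda>i. if i = 0 then (int ?n, cells_of y)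
    else if i \<in> {3} then wtape (off 0) ([] @ drop 0 y) else ts i)"
    using off[of 0] k K ts by (intro ex_copy) auto
  then have 1: "ex (copy 0 {3}) ts (2 * ?n + 1) ?t1"
    by (rule exec_eq) auto
  let ?t2 = "ts(0 := (0, cells_of y), 3 := (off 0, \<lambda>z. cells_of y (z - off 0)))"
  have "ex (rewind 0 {0, 3}) ?t1 (2 * ?n + 5) (slide {0, 3} (- int ?n) ?t1)"
    using K k(1) by (intro ex_rewind) auto
  then have 2: "ex (rewind 0 {0, 3}) ?t1 (2 * ?n + 5) ?t2"
    by (rule exec_eq) (auto simp: slide_def wtape_def)
  have "\<exists>ts'. ex (simulate M 2 3) ?t2 (2 * t + 3) ts' \<and> ts' 2 = var (Work (fst (run M y t))) \<and>
    (\<forall>i<tapes M. \<exists>vt. marked (fresh M) (off i) (length y + t) vt (ts' (3 + i))) \<and>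
    (\<forall>i. i \<noteq> 2 \<and> \<not> (3 \<le> i \<and> i < 3 + tapes M) \<longrightarrow> ts' i = ?t2 i)"
    using M G(1) K ts off k by (intro ex_simulate) auto
  then obtain t3 where 3: "ex (simulate M 2 3) ?t2 (2 * t + 3) t3" "t3 2 = var (Work (fst (run M y t)))"
    "\<forall>i<tapes M. \<exists>vt. marked (fresh M) (off i) (?n + t) vt (t3 (3 + i))"
    "\<And>i. i \<noteq> 2 \<and> \<not> (3 \<le> i \<and> i < 3 + tapes M) \<Longrightarrow> t3 i = ?t2 i"
    by blast
  obtain vt where vt: "\<And>i. i < tapes M \<Longrightarrow> marked (fresh M) (off i) (?n + t) (vt i) (t3 (3 + i))"
    using 3(3) by metis
  have t3: "t3 0 = (0, cells_of y)" "t3 1 = var f" using 3(4)[of 0] 3(4)[of 1] ts by auto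
  have test: "((reads t3 2 = Work (acc M)) = (reads t3 1 = Blank)) \<longleftrightarrow> (y \<in> L) = (f = Blank)"
    using t3 3(2) M(2) k by (auto simp: reads_def)
  let ?m = "tapes M * (4 * (?n + t) + 13)"
  let ?c = "Cond (\<lambda>rd. (rd 2 = Work (acc M)) = (rd 1 = Blank))
       (Act (\<lambda>_. [1 \<mapsto> (Bit True, Stay)]) ;; erase_block 3 (tapes M) ;; decr 0 1 (Work 0))
       (Act (\<lambda>_. [1 \<mapsto> (Bit False, Stay)]))"
  have fin: "\<exists>ts'. ex ?c t3 (?m + 4 * ?n + 17) ts' \<and>
    (if (y \<in> L) = (f = Blank)
     then first_inv M (dec y) (if val y = 0 then Work 0 else Bit True) ts'
     else ts' 1 = var (Bit False))"
  proof (cases "(y \<in> L) = (f = Blank)")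
    case False
    have "ex (Act (\<lambda>_. [1 \<mapsto> (Bit False, Stay)])) t3 1 (t3(1 := var (Bit False)))"
      using t3 K Bit_in by (intro exec_Act) auto
    then have "ex ?c t3 (?m + 4 * ?n + 17) (t3(1 := var (Bit False)))"
      using False test by (intro exec.CondF) auto
    then show ?thesis using False by (intro exI[of _ "t3(1 := var (Bit False))"]) (simp del: One_nat_def)
  next
    case True
    let ?t4 = "t3(1 := var (Bit True))"
    have 4: "ex (Act (\<lambda>_. [1 \<mapsto> (Bit True, Stay)])) t3 1 ?t4"
      using t3 K Bit_in by (intro exec_Act) auto
    have "marked (fresh M) (off i) (?n + t) (vt i) (?t4 (3 + i))" if "i < tapes M" for i
      using vt[OF that] by simp
    then obtain off' t5 where 5: "ex (erase_block 3 (tapes M)) ?t4 (?m + 1) t5"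
      "\<And>i. i < tapes M \<Longrightarrow> t5 (3 + i) = wtape (off' i) []"
      "\<And>i. \<not> (3 \<le> i \<and> i < 3 + tapes M) \<Longrightarrow> t5 i = ?t4 i"
      using ex_erase_block[of 3 "tapes M" "fresh M" off "?n + t" vt ?t4] K fresh_neq(1) by blast
    let ?t6 = "t5(0 := (0, cells_of (dec y)), 1 := var (if val y = 0 then Work 0 else Bit True))"
    have 6: "ex (decr 0 1 (Work 0)) t5 (4 * ?n + 12) ?t6"
      using G(2) K 5(3)[of 0] 5(3)[of 1] t3 by (intro ex_decr) auto
    have "ex ?c t3 (?m + 4 * ?n + 17) ?t6"
      using exec.Seq[OF 4 exec.Seq[OF 5(1) 6 order.refl] order.refl] True test by (intro exec.CondT) auto
    moreover have "first_inv M (dec y) (if val y = 0 then Work 0 else Bit True) ?t6"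
      using 5(2) 5(3)[of 2] 3(2) by (auto simp: first_inv_def)
    ultimately show ?thesis using True by auto
  qed
  then obtain ts' where ts': "ex ?c t3 (?m + 4 * ?n + 17) ts'"
    "if (y \<in> L) = (f = Blank)
     then first_inv M (dec y) (if val y = 0 then Work 0 else Bit True) ts'
     else ts' 1 = var (Bit False)" by blast
  have "ex (first_body M) ts (first_time M (?n + t) - 1) ts'"
    unfolding first_body_def
    by (rule exec.Seq[OF 1 exec.Seq[OF 2 exec.Seq[OF 3(1) ts'(1) order.refl] order.refl]])
      (simp add: first_time_def algebra_simps)
  then show ?thesis using ts'(2) by blast
qed

text \<open>Induction on \<open>val y\<close>, the number of rounds that may still follow. The
  comparison with \<open>f = Blank\<close> covers the first round and the later ones at once, and
  the first failing round ends the loop with \<open>Bit False\<close>.\<close>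

lemma ex_first_prog:
  assumes M: "wf_tm M" "\<And>y. length y = n \<Longrightarrow> \<exists>t\<le>T. fst (run M y t) = (if y \<in> L then acc M else rej M)"
    and G: "tm_symbols M \<subseteq> G" "Work 0 \<in> G" and K: "K = 3 + tapes M"
    and "first_inv M y f ts" "f = Blank \<or> f = Bit True" "length y = n"
  shows "\<exists>ts'. ex (first_prog M) ts ((val y + 1) * first_time M (n + T) + 1) ts' \<and>
    ts' 1 = var (if (y \<in> L) = (f = Blank) \<and> (\<forall>z. length z = n \<and> val z < val y \<longrightarrow> z \<notin> L)
      then Work 0 else Bit False)"
  using assms(6-)
proof (induction "val y" arbitrary: y f ts rule: less_induct)
  case less
  obtain t where t: "t \<le> T" "fst (run M y t) = (if y \<in> L then acc M else rej M)"
    using M(2) less.prems(3) by blast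
  let ?I = "first_time M (n + T)"
  obtain ts1 where ts1: "ex (first_body M) ts (first_time M (n + t) - 1) ts1"
    "if (y \<in> L) = (f = Blank)
     then first_inv M (dec y) (if val y = 0 then Work 0 else Bit True) ts1
     else ts1 1 = var (Bit False)"
    using ex_first_body[OF M(1) t(2) G K less.prems(1)] less.prems(3) by auto
  have "first_time M (n + t) \<le> ?I" using t(1) unfolding first_time_def by (intro mult_left_mono) auto
  then have b: "ex (first_body M) ts (?I - 1) ts1" using ts1(1) exec_mono by fastforce
  have I: "?I \<ge> 1" by (simp add: first_time_def)
  have test: "reads ts 1 \<in> {Blank, Bit True}" using less.prems by (auto simp: first_inv_def reads_def)
  have stop: "\<exists>ts'. ex (first_prog M) ts ((val y + 1) * ?I + 1) ts' \<and> ts' 1 = var s"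
    if "ts1 1 = var s" "s \<notin> {Blank, Bit True}" for s
  proof -
    have "ex (first_prog M) ts1 1 ts1"
      unfolding first_prog_def using that by (intro exec.WhileF) (auto simp: reads_def)
    then have "ex (first_prog M) ts ((val y + 1) * ?I + 1) ts1"
      unfolding first_prog_def using test I
      by (intro exec.WhileT[OF _ b]) auto
    then show ?thesis using that by blast
  qed
  show ?case
  proof (cases "(y \<in> L) = (f = Blank)")
    case False
    then show ?thesis using stop[of "Bit False"] ts1(2) by (simp del: One_nat_def)
  next
    case True
    show ?thesis
    proof (cases "val y = 0")
      case True
      then show ?thesis using stop[of "Work 0"] ts1(2) \<open>(y \<in> L) = (f = Blank)\<close>
        by (simp add: first_inv_def del: One_nat_def)
    next
      case False
      have d: "val (dec y) = val y - 1" using False by (simp add: val_dec)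
      then obtain ts2 where ts2: "ex (first_prog M) ts1 (val y * ?I + 1) ts2"
        "ts2 1 = var (if dec y \<notin> L \<and> (\<forall>z. length z = n \<and> val z < val y - 1 \<longrightarrow> z \<notin> L)
          then Work 0 else Bit False)"
        using less.hyps[of "dec y" "Bit True" ts1] ts1(2) True False less.prems(3) by auto
      \<comment> \<open>\<open>val\<close> is injective at each length, so the words below
        \<open>y\<close> are \<open>dec y\<close> and the words below \<open>dec y\<close>.\<close>
      have iff: "(dec y \<notin> L \<and> (\<forall>z. length z = n \<and> val z < val y - 1 \<longrightarrow> z \<notin> L)) \<longleftrightarrow>
        (\<forall>z. length z = n \<and> val z < val y \<longrightarrow> z \<notin> L)"
      proof -
        have "z = dec y \<or> val z < val y - 1" if "length z = n" "val z < val y" for z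
          using val_inj[of z "dec y"] that d less.prems(3) by fastforce
        moreover have "length (dec y) = n" "val (dec y) < val y" using d False less.prems(3) by auto
        moreover have "val z < val y" if "val z < val y - 1" for z using that by simp
        ultimately show ?thesis by blast
      qed
      have "ex (first_prog M) ts ((val y + 1) * ?I + 1) ts2"
        unfolding first_prog_def using test I
        by (intro exec.WhileT[OF _ b ts2(1)[unfolded first_prog_def]]) auto
      moreover have "ts2 1 = var (if (y \<in> L) = (f = Blank) \<and>
          (\<forall>z. length z = n \<and> val z < val y \<longrightarrow> z \<notin> L) then Work 0 else Bit False)"
        using ts2(2) True unfolding iff by simp
      ultimately show ?thesis by blast
    qed
  qed
qed

end

theorem decides_in_first:
  assumes "decides_in T M L"
  shows "\<exists>M' k. decides_in (\<lambda>n. 2 ^ n * (k * (n + T n + 10)) + 2) M' (first L)"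
proof -
  have M: "wf_tm M" "\<And>y. \<exists>t\<le>T (length y). fst (run M y t) = (if y \<in> L then acc M else rej M)"
    using assms by (auto simp: decides_in_def)
  define G where "G = {Blank, Bit False, Bit True, Work 0} \<union> tm_symbols M"
  define M' where "M' = tm_of (3 + tapes M) G (first_prog M) (\<lambda>rd. rd 1 = Work 0)"
  interpret bit_alphabet "3 + tapes M" G
  proof
    show "Bit b \<in> G" for b by (cases b) (auto simp: G_def)
  qed (simp add: G_def)
  have wf: "wf_tm M'"
    unfolding M'_def by (rule wf_tm_of) (use finite_tm_symbols[OF M(1)] in \<open>auto simp: G_def\<close>)
  have "\<exists>t\<le>2 ^ length x * (4 * (tapes M + 2) * (length x + T (length x) + 10)) + 2.
    fst (run M' x t) = (if x \<in> first L then acc M' else rej M')" for x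
  proof -
    let ?I = "first_time M (length x + T (length x))"
    have inv: "first_inv M x Blank (init_env x)"
      unfolding first_inv_def
      by (auto simp: init_env_def var_Blank wtape_Nil intro: exI[of _ Blank] exI[of _ 0])
    have "\<exists>ts'. ex (first_prog M) (init_env x) ((val x + 1) * ?I + 1) ts' \<and>
      ts' 1 = var (if (x \<in> L) = (Blank = Blank) \<and> (\<forall>z. length z = length x \<and> val z < val x \<longrightarrow> z \<notin> L)
        then Work 0 else Bit False)"
    proof (rule ex_first_prog[OF M(1) _ _ _ refl inv])
      show "\<exists>t\<le>T (length x). fst (run M y t) = (if y \<in> L then acc M else rej M)"
        if "length y = length x" for y using M(2)[of y] that by simp
    qed (auto simp: G_def)
    then obtain ts where ts: "ex (first_prog M) (init_env x) ((val x + 1) * ?I + 1) ts"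
      "ts 1 = var (if x \<in> first L then Work 0 else Bit False)"
      unfolding first_def by auto
    obtain t where t: "t \<le> (val x + 1) * ?I + 1 + 1"
      "run M' x t = (if reads ts 1 = Work 0 then 0 else 1, listed (3 + tapes M) ts)"
      unfolding M'_def using run_tm_of[OF ts(1)] by auto
    \<comment> \<open>There is one round for each value from \<open>val x\<close> down to 0, hence
      at most \<open>2 ^ length x\<close> rounds. The summand 2 in the time bound pays for the last
      loop test and the halting step.\<close>
    have "(val x + 1) * ?I \<le> 2 ^ length x * ?I" using val_less[of x] by (intro mult_right_mono) auto
    then have "t \<le> 2 ^ length x * ?I + 2" using t(1) by simp
    moreover have "?I = 4 * (tapes M + 2) * (length x + T (length x) + 10)"
      by (simp add: first_time_def algebra_simps)
    ultimately show ?thesis using t(2) ts(2) by (intro exI[of _ t]) (auto simp: reads_def M'_def)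
  qed
  then show ?thesis using wf unfolding decides_in_def by blast
qed

section \<open>Parsing, counting and printing\<close>

text \<open>Tape 4 remembers the first bit of the current pair. An equal second bit completes a
  doubled letter of the first component, which goes to tape 1; a different one reveals the
  separator. The stop signal \<open>Work 0\<close> is at the same time the initial verdict of the
  later length comparison.\<close>

definition parse_act :: "(nat \<Rightarrow> sym) \<Rightarrow> nat \<rightharpoonup> sym \<times> dir" where
  "parse_act rd =
     (if rd 4 = Blank then [0 \<mapsto> (rd 0, Move_Right), 4 \<mapsto> (rd 0, Stay)]
      else if rd 4 = rd 0 then [0 \<mapsto> (rd 0, Move_Right), 4 \<mapsto> (Blank, Stay), 1 \<mapsto> (rd 0, Move_Right)]
      else [0 \<mapsto> (rd 0, Move_Right), 4 \<mapsto> (Work 0, Stay)])"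

definition parse :: prog where
  "parse = While (\<lambda>rd. rd 4 \<noteq> Work 0) (Act parse_act)"

definition capped_succ :: "nat \<Rightarrow> sym \<Rightarrow> sym" where
  "capped_succ N s = (case s of Work c \<Rightarrow> Work (min N (Suc c)) | _ \<Rightarrow> s)"

text \<open>An underflow means that \<open>i\<close> is smaller than the length of \<open>x\<close>;
  its report \<open>Work 1\<close> is never overwritten by anything else. Capping the length at
  \<open>N\<close> keeps tape 7 a finite memory that still tells whether the length is below
  \<open>N\<close>.\<close>

definition count_down :: "nat \<Rightarrow> prog" where
  "count_down N = While (\<lambda>rd. rd 2 \<noteq> Blank)
     (Act (\<lambda>rd. [2 \<mapsto> (rd 2, Move_Right), 7 \<mapsto> (capped_succ N (rd 7), Stay)]) ;; decr 1 4 (Work 1))"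

definition test_zero :: prog where
  "test_zero = While (\<lambda>rd. rd 1 = Bit False) (mv {1} Move_Right) ;;
     Cond (\<lambda>rd. rd 1 = Bit True) (Act (\<lambda>_. [4 \<mapsto> (Work 1, Stay)])) skip"

fun emit :: "nat \<Rightarrow> word \<Rightarrow> prog" where
  "emit out [] = skip"
| "emit out (b # bs) = Act (\<lambda>_. [out \<mapsto> (Bit b, Move_Right)]) ;; emit out bs"

definition emit_each :: "nat \<Rightarrow> nat \<Rightarrow> word \<Rightarrow> prog" where
  "emit_each j out bs = While (\<lambda>rd. rd j \<noteq> Blank) (emit out bs ;; mv {j} Move_Right)"

text \<open>If the head of tape 2 starts at position \<open>k\<close> of a word of length
  \<open>n\<close>, the nested loops emit \<open>(n - k) * n\<close> copies. Starting at 0 gives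
  \<open>n^2\<close>, starting at 1 gives \<open>n^2 - n\<close>.\<close>

definition emit_square :: "nat \<Rightarrow> word \<Rightarrow> prog" where
  "emit_square out bs = While (\<lambda>rd. rd 2 \<noteq> Blank)
     (emit_each 3 out bs ;; rewind 3 {3} ;; mv {2} Move_Right)"

abbreviation copies :: "nat \<Rightarrow> word \<Rightarrow> word" where
  "copies k bs \<equiv> concat (replicate k bs)"

lemma copies_add: "copies (a + b) bs = copies a bs @ copies b bs"
  by (simp add: replicate_add)

lemma pair_word_Nil: "pair_word [] y = False # True # y"
  by (simp add: pair_word_def)

lemma pair_word_Cons: "pair_word (b # w) y = b # b # pair_word w y"
  by (simp add: pair_word_def)

lemma length_pair_word: "length (pair_word w y) = 2 * length w + 2 + length y"
  by (induction w) (auto simp: pair_word_Nil pair_word_Cons)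

lemma drop_eq_Cons_nth: "drop p u = b # v \<Longrightarrow> p < length u \<and> u ! p = b \<and> drop (Suc p) u = v"
  by (metis Cons_nth_drop_Suc drop_eq_Nil2 linorder_not_less list.discI list.inject)

context bit_alphabet
begin

lemma ex_parse:
  assumes "4 < K" "Work 0 \<in> G"
    and "drop p u = pair_word w x" "ts 0 = (int p, cells_of u)" "ts 1 = wtape 0 v" "ts 4 = var Blank"
  shows "ex parse ts (4 * length w + 5)
    (ts(0 := (int (p + 2 * length w + 2), cells_of u), 1 := wtape 0 (v @ w), 4 := var (Work 0)))"
  using assms(3-)
proof (induction w arbitrary: p v ts)
  case Nil
  then have p: "p < length u" "u ! p = False" "Suc p < length u" "u ! Suc p = True"
    using drop_eq_Cons_nth[of p u False] drop_eq_Cons_nth[of "Suc p" u True] by (auto simp: pair_word_Nil)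
  let ?t1 = "ts(0 := (int (Suc p), cells_of u), 4 := var (Bit False))"
  let ?t2 = "ts(0 := (int (Suc (Suc p)), cells_of u), 4 := var (Work 0))"
  have u: "(cells_of u)(int k := Bit (u ! k)) = cells_of u" if "k < length u" for k
    using that by (simp add: cells_of_update)
  have 1: "ex (Act parse_act) ts 1 ?t1"
    using assms(1) Nil p Bit_in u[of p] by (intro exec_Act) (auto simp: parse_act_def reads_def)
  have 2: "ex (Act parse_act) ?t1 1 ?t2"
    using assms(1,2) Nil p Bit_in u[of "Suc p"] cells_of_nth[of "Suc p" u]
    by (intro exec_Act) (auto simp: parse_act_def reads_def simp del: cells_of_nth)
  have 3: "ex parse ?t2 1 ?t2" unfolding parse_def by (rule exec.WhileF) (auto simp: reads_def)
  have "ex parse ?t1 3 ?t2"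
    unfolding parse_def by (rule exec.WhileT[OF _ 2 3[unfolded parse_def]]) (auto simp: reads_def)
  then have "ex parse ts 5 ?t2"
    unfolding parse_def by (intro exec.WhileT[OF _ 1]) (auto simp: reads_def Nil)
  then show ?case by (rule exec_eq) (use Nil in auto)
next
  case (Cons b w)
  then have p: "p < length u" "u ! p = b" "Suc p < length u" "u ! Suc p = b" "drop (p + 2) u = pair_word w x"
    using drop_eq_Cons_nth[of p u b] drop_eq_Cons_nth[of "Suc p" u b] by (auto simp: pair_word_Cons)
  let ?t1 = "ts(0 := (int (Suc p), cells_of u), 4 := var (Bit b))"
  let ?t2 = "ts(0 := (int (p + 2), cells_of u), 4 := var Blank, 1 := wtape 0 (v @ [b]))"
  have u: "(cells_of u)(int k := Bit (u ! k)) = cells_of u" if "k < length u" for k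
    using that by (simp add: cells_of_update)
  have 1: "ex (Act parse_act) ts 1 ?t1"
    using assms(1) Cons.prems p Bit_in u[of p] by (intro exec_Act) (auto simp: parse_act_def reads_def)
  have 2: "ex (Act parse_act) ?t1 1 ?t2"
    using assms(1) Cons.prems p Bit_in Blank_in u[of "Suc p"] cells_of_nth[of "Suc p" u]
    by (intro exec_Act) (auto simp: parse_act_def reads_def simp del: cells_of_nth)
  have 3: "ex parse ?t2 (4 * length w + 5)
    (?t2(0 := (int (p + 2 + 2 * length w + 2), cells_of u), 1 := wtape 0 ((v @ [b]) @ w), 4 := var (Work 0)))"
    using p by (intro Cons.IH) auto
  have "ex parse ?t1 (4 * length w + 7)
    (?t2(0 := (int (p + 2 + 2 * length w + 2), cells_of u), 1 := wtape 0 ((v @ [b]) @ w), 4 := var (Work 0)))"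
    unfolding parse_def by (rule exec.WhileT[OF _ 2 3[unfolded parse_def]]) (auto simp: reads_def)
  then have "ex parse ts (4 * length w + 9)
    (?t2(0 := (int (p + 2 + 2 * length w + 2), cells_of u), 1 := wtape 0 ((v @ [b]) @ w), 4 := var (Work 0)))"
    unfolding parse_def by (intro exec.WhileT[OF _ 1]) (auto simp: reads_def Cons.prems)
  then show ?case by (rule exec_eq) auto
qed

text \<open>After an underflow the counter has wrapped around, so its value is claimed only while
  \<open>good'\<close> holds.\<close>

lemma ex_count_down:
  assumes K: "7 < K" and G: "Work 1 \<in> G" "\<And>c. c \<le> N \<Longrightarrow> Work c \<in> G"
    and "ts 1 = (0, cells_of v)" "ts 2 = (int j, cells_of x)" "j \<le> length x" "ts 4 = var (if good then Work 0 else Work 1)"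
      "ts 7 = var (Work (min N j))"
  shows "\<exists>v' good'. ex (count_down N) ts ((length x - j) * (4 * length v + 16) + 1)
      (ts(1 := (0, cells_of v'), 2 := (int (length x), cells_of x), 4 := var (if good' then Work 0 else Work 1),
         7 := var (Work (min N (length x))))) \<and>
    length v' = length v \<and> (good' \<longleftrightarrow> good \<and> length x - j \<le> val v) \<and> (good' \<longrightarrow> val v' = val v - (length x - j))"
  using assms(4-)
proof (induction "length x - j" arbitrary: j v good ts)
  case 0
  have "ex (count_down N) ts 1 ts"
    unfolding count_down_def by (rule exec.WhileF) (use 0 in \<open>auto simp: reads_def\<close>)
  then have "ex (count_down N) ts 1 (ts(1 := (0, cells_of v), 2 := (int (length x), cells_of x),
      4 := var (if good then Work 0 else Work 1), 7 := var (Work (min N (length x)))))"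
    by (rule exec_eq) (use 0 in \<open>auto simp: fun_eq_iff\<close>)
  then show ?case unfolding 0(1)[symmetric] mult_0 add_0 by (intro exI conjI, assumption) auto
next
  case (Suc m)
  let ?good = "good \<and> val v \<noteq> 0"
  let ?t1 = "ts(2 := (int (Suc j), cells_of x), 7 := var (Work (min N (Suc j))))"
  let ?t2 = "?t1(1 := (0, cells_of (dec v)), 4 := var (if ?good then Work 0 else Work 1))"
  have j: "j < length x" using Suc by simp
  have 1: "ex (Act (\<lambda>rd. [2 \<mapsto> (rd 2, Move_Right), 7 \<mapsto> (capped_succ N (rd 7), Stay)])) ts 1 ?t1"
    using K G Suc.prems j cells_of_update[of j x "x ! j"]
    by (intro exec_Act) (auto simp: capped_succ_def reads_def min_def)
  have "ex (decr 1 4 (Work 1)) ?t1 (4 * length v + 12)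
    (?t1(1 := (0, cells_of (dec v)), 4 := var (if val v = 0 then Work 1 else (if good then Work 0 else Work 1))))"
    using K G Suc.prems by (intro ex_decr) auto
  then have 2: "ex (decr 1 4 (Work 1)) ?t1 (4 * length v + 12) ?t2"
    by (rule exec_eq) auto
  have m: "m = length x - Suc j" using Suc(2) by simp
  have "\<exists>v' good'. ex (count_down N) ?t2 ((length x - Suc j) * (4 * length (dec v) + 16) + 1)
      (?t2(1 := (0, cells_of v'), 2 := (int (length x), cells_of x), 4 := var (if good' then Work 0 else Work 1),
         7 := var (Work (min N (length x))))) \<and>
    length v' = length (dec v) \<and> (good' \<longleftrightarrow> ?good \<and> length x - Suc j \<le> val (dec v)) \<and>
    (good' \<longrightarrow> val v' = val (dec v) - (length x - Suc j))"
    using j by (intro Suc.hyps(1)[OF m]) auto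
  then obtain v' good' where IH: "ex (count_down N) ?t2 (m * (4 * length v + 16) + 1)
      (?t2(1 := (0, cells_of v'), 2 := (int (length x), cells_of x), 4 := var (if good' then Work 0 else Work 1),
         7 := var (Work (min N (length x)))))"
    "length v' = length v" "good' \<longleftrightarrow> ?good \<and> m \<le> val (dec v)" "good' \<longrightarrow> val v' = val (dec v) - m"
    unfolding m by auto
  have "ex (count_down N) ts ((length x - j) * (4 * length v + 16) + 1)
      (?t2(1 := (0, cells_of v'), 2 := (int (length x), cells_of x), 4 := var (if good' then Work 0 else Work 1),
         7 := var (Work (min N (length x)))))"
    unfolding count_down_def
    by (rule exec.WhileT[OF _ exec.Seq[OF 1 2 order.refl] IH(1)[unfolded count_down_def]])
      (use j Suc.prems Suc(2)[symmetric] in \<open>auto simp: reads_def\<close>)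
  moreover have "?t2(1 := (0, cells_of v'), 2 := (int (length x), cells_of x), 4 := var (if good' then Work 0 else Work 1),
         7 := var (Work (min N (length x))))
    = ts(1 := (0, cells_of v'), 2 := (int (length x), cells_of x), 4 := var (if good' then Work 0 else Work 1),
         7 := var (Work (min N (length x))))"
    by (auto simp: fun_eq_iff)
  moreover have "good' \<longleftrightarrow> good \<and> length x - j \<le> val v" "good' \<longrightarrow> val v' = val v - (length x - j)"
    using IH(3,4) val_dec[of v] Suc(2) by auto
  ultimately show ?case using IH(2) by auto
qed

lemma ex_test_zero:
  assumes K: "4 < K" and G: "Work 1 \<in> G" and ts: "ts 1 = (0, cells_of v)" "ts 4 = var s"
  shows "\<exists>t. ex test_zero ts (2 * length v + 10) (ts(1 := t, 4 := var (if val v = 0 then s else Work 1)))"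
proof -
  \<comment> \<open>\<open>m\<close> is the position at which the scan over zeros stops: the first
    one, or the blank behind the word.\<close>
  obtain m where m: "m \<le> length v" "\<And>k. k < m \<Longrightarrow> v ! k = False" "if val v = 0 then m = length v else m < length v \<and> v ! m"
  proof (cases v rule: word_cases)
    case (1 m)
    then show ?thesis by (intro that[of m]) auto
  next
    case (2 m v')
    then show ?thesis by (intro that[of m]) (auto simp: nth_append)
  qed
  have loop: "ex (While (\<lambda>rd. rd 1 = Bit False) (mv {1} Move_Right)) (ts(1 := (int (m - k), cells_of v))) (2 * k + 1)
    (ts(1 := (int m, cells_of v)))" if "k \<le> m" for k
    using that
  proof (induction k)
    case 0
    have "cells_of v (int m) \<noteq> Bit False"
      using m(3) by (cases "val v = 0") auto
    then show ?case by (intro exec_eq[OF exec.WhileF[OF _ order.refl]]) (auto simp: reads_def)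
  next
    case (Suc k)
    have 1: "ex (mv {1} Move_Right) (ts(1 := (int (m - Suc k), cells_of v))) 1 (ts(1 := (int (m - k), cells_of v)))"
      by (rule exec_eq[OF ex_mv[OF _ order.refl]]) (use Suc K in \<open>auto simp: slide_def\<close>)
    have "cells_of v (int (m - Suc k)) = Bit False"
      using Suc.prems m by (subst cells_of_nth) auto
    then show ?case using Suc by (intro exec.WhileT[OF _ 1 Suc.IH]) (auto simp: reads_def)
  qed
  have 1: "ex (While (\<lambda>rd. rd 1 = Bit False) (mv {1} Move_Right)) ts (2 * m + 1) (ts(1 := (int m, cells_of v)))"
    using loop[of m] ts(1) by (simp add: fun_upd_idem)
  let ?t = "ts(1 := (int m, cells_of v))"
  have 2: "ex (Cond (\<lambda>rd. rd 1 = Bit True) (Act (\<lambda>_. [4 \<mapsto> (Work 1, Stay)])) skip) ?t 2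
    (?t(4 := var (if val v = 0 then s else Work 1)))"
  proof (cases "val v = 0")
    case True
    have "ex skip ?t 1 ?t" by (simp add: ex_skip)
    then have "ex skip ?t 1 (?t(4 := var s))"
      by (rule exec_eq) (use ts in \<open>auto simp: fun_eq_iff\<close>)
    then show ?thesis using True m(3) by (intro exec.CondF) (auto simp: reads_def)
  next
    case False
    have "ex (Act (\<lambda>_. [4 \<mapsto> (Work 1, Stay)])) ?t 1 (?t(4 := var (Work 1)))"
      using K G ts by (intro exec_Act) auto
    then show ?thesis using False m(3) by (intro exec.CondT) (auto simp: reads_def)
  qed
  have "ex test_zero ts (2 * length v + 10) (?t(4 := var (if val v = 0 then s else Work 1)))"
    unfolding test_zero_def by (rule exec.Seq[OF 1 2]) (use m(1) in simp)
  then show ?thesis by blast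
qed

lemma ex_emit:
  "out < K \<Longrightarrow> ts out = wtape 0 v \<Longrightarrow> 2 * length bs + 1 \<le> n \<Longrightarrow> ex (emit out bs) ts n (ts(out := wtape 0 (v @ bs)))"
proof (induction bs arbitrary: v ts n)
  case Nil
  then have "ts(out := wtape 0 (v @ [])) = ts" by (auto simp: fun_eq_iff)
  then show ?case using ex_skip[of n ts] Nil by simp
next
  case (Cons b bs)
  have 1: "ex (Act (\<lambda>_. [out \<mapsto> (Bit b, Move_Right)])) ts 1 (ts(out := wtape 0 (v @ [b])))"
    using Cons.prems Bit_in by (intro exec_Act) auto
  have 2: "ex (emit out bs) (ts(out := wtape 0 (v @ [b]))) (2 * length bs + 1) (ts(out := wtape 0 (v @ b # bs)))"
    by (rule exec_eq[OF Cons.IH[where v = "v @ [b]" and n = "2 * length bs + 1"]]) (use Cons.prems in auto)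
  show ?case unfolding emit.simps by (rule exec.Seq[OF 1 2]) (use Cons.prems in simp)
qed

lemma ex_emit_each:
  assumes K: "out < K" "j < K" "j \<noteq> out"
    and "ts j = (int k, cells_of x)" "k \<le> length x" "ts out = wtape 0 v"
  shows "ex (emit_each j out bs) ts ((length x - k) * (2 * length bs + 4) + 1)
    (ts(j := (int (length x), cells_of x), out := wtape 0 (v @ copies (length x - k) bs)))"
  using assms(4-)
proof (induction "length x - k" arbitrary: k v ts)
  case 0
  have "ex (emit_each j out bs) ts 1 ts"
    unfolding emit_each_def by (rule exec.WhileF) (use 0 in \<open>auto simp: reads_def\<close>)
  then show ?case by (rule exec_eq) (use 0 in \<open>auto simp: fun_eq_iff\<close>)
next
  case (Suc m)
  let ?t1 = "ts(out := wtape 0 (v @ bs))"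
  let ?t2 = "ts(out := wtape 0 (v @ bs), j := (int (Suc k), cells_of x))"
  have k: "k < length x" "m = length x - Suc k" using Suc(2) by auto
  have 1: "ex (emit out bs) ts (2 * length bs + 1) ?t1"
    using Suc.prems K by (intro ex_emit) auto
  have 2: "ex (mv {j} Move_Right) ?t1 1 ?t2"
    by (rule exec_eq[OF ex_mv[OF _ order.refl]]) (use K Suc.prems in \<open>auto simp: slide_def\<close>)
  have 3: "ex (emit_each j out bs) ?t2 (m * (2 * length bs + 4) + 1)
    (?t2(j := (int (length x), cells_of x), out := wtape 0 ((v @ bs) @ copies m bs)))"
    unfolding k(2) using k K by (intro Suc.hyps(1)) auto
  have "ex (emit_each j out bs) ts ((length x - k) * (2 * length bs + 4) + 1)
    (?t2(j := (int (length x), cells_of x), out := wtape 0 ((v @ bs) @ copies m bs)))"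
    unfolding emit_each_def
    by (rule exec.WhileT[OF _ exec.Seq[OF 1 2 order.refl] 3[unfolded emit_each_def]])
      (use k(1) Suc.prems Suc(2)[symmetric] in \<open>auto simp: reads_def\<close>)
  then show ?case by (rule exec_eq) (use Suc(2)[symmetric] K(3) in \<open>auto simp: fun_eq_iff\<close>)
qed

lemma ex_emit_square:
  assumes K: "out < K" "3 < out"
    and "ts 2 = (int k, cells_of x)" "ts 3 = (0, cells_of x)" "k \<le> length x" "ts out = wtape 0 v"
  shows "ex (emit_square out bs) ts ((length x - k) * (length x * (2 * length bs + 6) + 12) + 1)
    (ts(2 := (int (length x), cells_of x), out := wtape 0 (v @ copies ((length x - k) * length x) bs)))"
  using assms(3-)
proof (induction "length x - k" arbitrary: k v ts)
  case 0
  have "ex (emit_square out bs) ts 1 ts"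
    unfolding emit_square_def by (rule exec.WhileF) (use 0 in \<open>auto simp: reads_def\<close>)
  then show ?case by (rule exec_eq) (use 0 in \<open>auto simp: fun_eq_iff\<close>)
next
  case (Suc m)
  let ?n = "length x"
  let ?v = "v @ copies ?n bs"
  let ?t1 = "ts(3 := (int ?n, cells_of x), out := wtape 0 ?v)"
  let ?t2 = "ts(out := wtape 0 ?v)"
  let ?t3 = "ts(out := wtape 0 ?v, 2 := (int (Suc k), cells_of x))"
  have k: "k < length x" "m = length x - Suc k" using Suc(2) by auto
  have 1: "ex (emit_each 3 out bs) ts (?n * (2 * length bs + 4) + 1) ?t1"
    using ex_emit_each[of out 3 ts 0 x v bs] Suc.prems K by simp
  have 2: "ex (rewind 3 {3}) ?t1 (2 * ?n + 5) ?t2"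
    by (rule exec_eq[OF ex_rewind[of "{3}" 3 _ ?n x "2 * ?n + 5"]]) (use K Suc.prems in \<open>auto simp: slide_def fun_eq_iff\<close>)
  have 3: "ex (mv {2} Move_Right) ?t2 1 ?t3"
    by (rule exec_eq[OF ex_mv[OF _ order.refl]]) (use K Suc.prems in \<open>auto simp: slide_def\<close>)
  have 4: "ex (emit_square out bs) ?t3 (m * (?n * (2 * length bs + 6) + 12) + 1)
    (?t3(2 := (int ?n, cells_of x), out := wtape 0 (?v @ copies (m * ?n) bs)))"
    unfolding k(2) using k K Suc.prems by (intro Suc.hyps(1)) auto
  have "ex (emit_square out bs) ts ((?n - k) * (?n * (2 * length bs + 6) + 12) + 1)
    (?t3(2 := (int ?n, cells_of x), out := wtape 0 (?v @ copies (m * ?n) bs)))"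
    unfolding emit_square_def
    by (rule exec.WhileT[OF _ exec.Seq[OF 1 exec.Seq[OF 2 3 order.refl] order.refl] 4[unfolded emit_square_def]])
      (use k(1) Suc.prems Suc(2)[symmetric] in \<open>auto simp: reads_def algebra_simps\<close>)
  then show ?case
    by (rule exec_eq) (use Suc(2)[symmetric] K in \<open>auto simp: fun_eq_iff copies_add\<close>)
qed

end

section \<open>Computing the weights\<close>

lemma val_append: "val (u @ v) = val u + 2 ^ length u * val v"
  by (induction u) (auto simp: algebra_simps)

lemma val_replicate_True: "val (replicate m True) = 2 ^ m - 1"
proof (induction m)
  case (Suc m)
  then show ?case by (cases "(2::nat) ^ m") auto
qed simp

lemma val_nat_word: "val (nat_word n) = n"
proof (induction n rule: less_induct)
  case (less n)
  show ?case
  proof (cases "n = 0")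
    case False
    then have "val (nat_word (n div 2)) = n div 2" using less by simp
    then show ?thesis using False by (subst nat_word.simps) (simp add: odd_two_times_div_two_succ)
  qed (simp add: nat_word.simps)
qed

lemma nat_word_val: "w = [] \<or> last w \<Longrightarrow> nat_word (val w) = w"
proof (induction w)
  case (Cons b w)
  then have IH: "nat_word (val w) = w" by (auto split: if_splits)
  have "val (b # w) \<noteq> 0"
  proof (cases w rule: rev_cases)
    case Nil
    then show ?thesis using Cons.prems by simp
  next
    case (snoc w' c)
    then show ?thesis using Cons.prems by (simp add: val_append)
  qed
  then show ?case using IH by (subst nat_word.simps) auto
qed (simp add: nat_word.simps)

lemma nat_word_power: "nat_word (2 ^ k) = copies k [False] @ [True]"
  using nat_word_val[of "replicate k False @ [True]"] by (simp add: val_append concat_replicate_single)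

lemma drop_pair_word: "drop (2 * length w + 2) (pair_word w x) = x"
  by (induction w) (auto simp: pair_word_Nil pair_word_Cons)

lemma pair_word_replicate: "pair_word (replicate k b @ w) y = copies k [b, b] @ pair_word w y"
  by (induction k) (auto simp: pair_word_Cons)

text \<open>By coprimality nothing cancels, so the denominator stays the power of two itself, whose
  binary notation is a run of zeros closed by a single one.\<close>

lemma rat_word_fraction:
  assumes "coprime (int a) (2 ^ k)"
  shows "rat_word (of_nat a / 2 ^ k) = pair_word (False # nat_word a) (copies k [False] @ [True])"
proof -
  have "(of_nat a / 2 ^ k :: rat) = Fract (int a) (2 ^ k)"
    by (simp add: Fract_of_int_quotient)
  then have "quotient_of (of_nat a / 2 ^ k) = (int a, 2 ^ k)"
    using assms by (simp add: quotient_of_Fract normalize_stable)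
  then show ?thesis by (simp add: rat_word_def int_word_def nat_power_eq nat_word_power)
qed

text \<open>This is \<open>(2^(n^2) - (2^n - 2)) / 2 = 2^(n^2-1) - 2^(n-1) + 1\<close>, factored so
  that for \<open>2 <= n\<close> the binary digits become visible: a one, then \<open>n - 2\<close>
  zeros, then \<open>n^2 - n\<close> ones.\<close>

definition special_numerator :: "nat \<Rightarrow> nat" where
  "special_numerator n = 1 + 2 ^ (n - 1) * (2 ^ (n\<^sup>2 - n) - 1)"

lemma nat_word_special_numerator:
  assumes "2 \<le> n"
  shows "nat_word (special_numerator n) = True # replicate (n - 2) False @ replicate ((n - 1) * n) True"
proof -
  have "(n - 1) * n = n\<^sup>2 - n" by (simp add: power2_eq_square diff_mult_distrib)
  moreover have "2 * 2 ^ (n - 2) = (2::nat) ^ (n - 1)"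
    using assms by (metis Suc_1 Suc_diff_le diff_Suc_Suc power_Suc)
  ultimately have "special_numerator n = val (True # replicate (n - 2) False @ replicate ((n - 1) * n) True)"
    by (simp add: special_numerator_def val_append val_replicate_True)
  then show ?thesis using assms by (simp only:) (rule nat_word_val, simp)
qed

text \<open>Below \<open>N\<close> special words are not guaranteed; the uniform distribution keeps
  full support there. The value 0 is given because a machine for the family is queried on all pairs
  \<open>(i, x)\<close>, including those of mismatched length.\<close>

definition weight :: "nat \<Rightarrow> language \<Rightarrow> nat \<Rightarrow> word \<Rightarrow> rat" where
  "weight N S i x =
     (if length x \<noteq> i then 0
      else if i < N then 1 / 2 ^ i
      else if x \<in> S then of_nat (special_numerator i) / 2 ^ i\<^sup>2
      else 1 / 2 ^ i\<^sup>2)"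

text \<open>The literals are pieces of \<open>rat_word\<close>: the doubled sign bit
  \<open>False\<close>, doubled digits of the numerator, the separator \<open>False, True\<close>,
  and a power of two as denominator. For a special word, two moves on tape 2 leave
  \<open>n - 2\<close> letters to be turned into doubled zeros, and after rewinding a single move
  leaves \<open>n - 1\<close> outer rounds for the doubled ones.\<close>

definition answer :: "nat \<Rightarrow> nat \<Rightarrow> nat tm \<Rightarrow> nat tm \<Rightarrow> prog" where
  "answer N out M1 M2 =
     Cond (\<lambda>rd. rd 4 = Work 1) (emit out [False, False, False, True, True])
     (Cond (\<lambda>rd. rd 7 \<noteq> Work N)
       (emit out [False, False, True, True, False, True] ;; emit_each 2 out [False] ;; emit out [True])
     (Cond (\<lambda>rd. rd 5 = Work (acc M1) \<or> rd 6 = Work (acc M2))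
       (emit out [False, False, True, True] ;; mv {2} Move_Right ;; mv {2} Move_Right ;;
        emit_each 2 out [False, False] ;; rewind 2 {2} ;; mv {2} Move_Right ;; emit_square out [True, True] ;;
        emit out [False, True] ;; rewind 2 {2} ;; emit_square out [False] ;; emit out [True])
       (emit out [False, False, True, True, False, True] ;; emit_square out [False] ;; emit out [True])))"

text \<open>Tapes: 0 holds the input \<open>(i, x)\<close>; 1 the binary counter \<open>i\<close>, decremented once per letter of \<open>x\<close>
  to compare \<open>i\<close> with the length of \<open>x\<close>; 2 and 3 hold copies of \<open>x\<close>, over which the loops run; 4 the result of
  the comparison (\<open>Work 0\<close> for equal); 5 and 6 the states of \<open>M1\<close> and \<open>M2\<close>; 7 the length of \<open>x\<close> capped at \<open>N\<close>.
  From tape 8 on there follow the tapes of \<open>M1\<close>, those of \<open>M2\<close>, and the output tape.\<close>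

definition main_prog :: "nat \<Rightarrow> nat tm \<Rightarrow> nat tm \<Rightarrow> prog" where
  "main_prog N M1 M2 = (let b = 8 + tapes M1; J = {2, 3, 8, b} in
     parse ;; copy 0 J ;; rewind 2 J ;; rewind 1 {1} ;; Act (\<lambda>_. [7 \<mapsto> (Work 0, Stay)]) ;;
     count_down N ;; rewind 2 {2} ;; test_zero ;; simulate M1 5 8 ;; simulate M2 6 b ;;
     answer N (b + tapes M2) M1 M2)"

context bit_alphabet
begin

lemma ex_answer:
  assumes K: "out < K" "7 < out" and N: "2 \<le> N" and M: "acc M1 \<noteq> rej M1" "acc M2 \<noteq> rej M2"
    and ts: "ts 2 = (0, cells_of x)" "ts 3 = (0, cells_of x)" "ts out = wtape 0 []"
      "ts 4 = var (if length x = i then Work 0 else Work 1)"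
      "ts 5 = var (Work (if x \<in> P then acc M1 else rej M1))"
      "ts 6 = var (Work (if x \<in> Q then acc M2 else rej M2))"
      "ts 7 = var (Work (min N (length x)))"
  shows "\<exists>ts'. ex (answer N out M1 M2) ts (20 * (length x * length x) + 80 * length x + 80) ts' \<and>
    ts' out = wtape 0 (rat_word (weight N (P \<union> Q) i x))"
proof -
  let ?n = "length x"
  let ?T = "20 * (?n * ?n) + 80 * ?n + 80"
  have sq: "ex (emit_square out bs) (ts(2 := (int k, cells_of x), out := wtape 0 v))
     ((?n - k) * (?n * (2 * length bs + 6) + 12) + 1)
     (ts(2 := (int ?n, cells_of x), out := wtape 0 (v @ copies ((?n - k) * ?n) bs)))" if "k \<le> ?n" for k v bs
    by (rule exec_eq[OF ex_emit_square[where x = x and v = v and k = k]]) (use K ts that in \<open>auto simp: fun_eq_iff\<close>)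
  have each: "ex (emit_each 2 out bs) (ts(2 := (int k, cells_of x), out := wtape 0 v))
     ((?n - k) * (2 * length bs + 4) + 1)
     (ts(2 := (int ?n, cells_of x), out := wtape 0 (v @ copies (?n - k) bs)))" if "k \<le> ?n" for k v bs
    by (rule exec_eq[OF ex_emit_each[where x = x and v = v and k = k]]) (use K ts that in \<open>auto simp: fun_eq_iff\<close>)
  have em: "ex (emit out bs) (ts(2 := (int k, cells_of x), out := wtape 0 v)) (2 * length bs + 1)
     (ts(2 := (int k, cells_of x), out := wtape 0 (v @ bs)))" for k v bs
    by (rule exec_eq[OF ex_emit[where v = v and n = "2 * length bs + 1"]]) (use K in \<open>auto simp: fun_eq_iff\<close>)
  have rw: "ex (rewind 2 {2}) (ts(2 := (int ?n, cells_of x), out := wtape 0 v)) (2 * ?n + 5)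
     (ts(2 := (int 0, cells_of x), out := wtape 0 v))" for v
    by (rule exec_eq[OF ex_rewind[of "{2}" 2 _ ?n x "2 * ?n + 5"]]) (use K in \<open>auto simp: slide_def fun_eq_iff\<close>)
  have rt: "ex (mv {2} Move_Right) (ts(2 := (int k, cells_of x), out := wtape 0 v)) 1
     (ts(2 := (int (Suc k), cells_of x), out := wtape 0 v))" for k v
    by (rule exec_eq[OF ex_mv[OF _ order.refl]]) (use K in \<open>auto simp: slide_def fun_eq_iff\<close>)
  have t0: "ts = ts(2 := (int 0, cells_of x), out := wtape 0 [])" using ts by (auto simp: fun_eq_iff)
  have r: "reads ts 4 = (if ?n = i then Work 0 else Work 1)" "reads ts 7 = Work (min N ?n)"
    "(reads ts 5 = Work (acc M1) \<or> reads ts 6 = Work (acc M2)) \<longleftrightarrow> x \<in> P \<union> Q"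
    using ts M by (auto simp: reads_def)
  have one: "rat_word (1 / 2 ^ k) = [False, False, True, True, False, True] @ copies k [False] @ [True]" for k
    using rat_word_fraction[of 1 k] by (simp add: nat_word.simps pair_word_Cons pair_word_Nil)
  consider "?n \<noteq> i" | "?n = i" "i < N" | "?n = i" "N \<le> i" "x \<in> P \<union> Q" | "?n = i" "N \<le> i" "x \<notin> P \<union> Q"
    by linarith
  then show ?thesis
  proof cases
    case 1
    have "rat_word 0 = [False, False, False, True, True]"
      by (simp add: rat_word_def int_word_def nat_word.simps pair_word_Cons pair_word_Nil)
    then have w: "rat_word (weight N (P \<union> Q) i x) = [] @ [False, False, False, True, True]"
      using 1 by (simp add: weight_def)
    have "ex (answer N out M1 M2) ts ?T (ts(2 := (int 0, cells_of x), out := wtape 0 ([] @ [False, False, False, True, True])))"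
      unfolding answer_def by (rule exec.CondT[OF _ em[of _ 0 "[]", folded t0]]) (use r 1 in auto)
    then show ?thesis unfolding w by (intro exI conjI, assumption) simp
  next
    case 2
    have w: "rat_word (weight N (P \<union> Q) i x) =
      (([] @ [False, False, True, True, False, True]) @ copies (?n - 0) [False]) @ [True]"
      using 2 one[of i] by (simp add: weight_def)
    have "ex (answer N out M1 M2) ts ?T (ts(2 := (int ?n, cells_of x),
        out := wtape 0 ((([] @ [False, False, True, True, False, True]) @ copies (?n - 0) [False]) @ [True])))"
      unfolding answer_def
      by (rule exec.CondF[OF _ exec.CondT[OF _ exec.Seq[OF em[of _ 0 "[]", folded t0]
            exec.Seq[OF each em order.refl] order.refl] order.refl]])
        (use r 2 in auto)
    then show ?thesis unfolding w by (intro exI conjI, assumption) simp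
  next
    case 3
    then have n: "2 \<le> ?n" using N by simp
    let ?v1 = "[] @ [False, False, True, True]"
    let ?v2 = "?v1 @ copies (?n - 2) [False, False]"
    let ?v3 = "?v2 @ copies ((?n - 1) * ?n) [True, True]"
    let ?v4 = "?v3 @ [False, True]"
    let ?v5 = "?v4 @ copies ((?n - 0) * ?n) [False]"
    let ?v6 = "?v5 @ [True]"
    \<comment> \<open>For \<open>n >= 2\<close> the factor \<open>2 ^ (n - 1)\<close> is even.
      Oddness makes the fraction reduced, so the emitted digits are those of
      \<open>quotient_of\<close>.\<close>
    have "odd (special_numerator ?n)" using n by (auto simp: special_numerator_def)
    then have "rat_word (of_nat (special_numerator ?n) / 2 ^ ?n\<^sup>2) =
      pair_word (False # nat_word (special_numerator ?n)) (copies (?n\<^sup>2) [False] @ [True])"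
      by (intro rat_word_fraction) simp
    also have "\<dots> = ?v6"
      using pair_word_replicate[of "(?n - 1) * ?n" True "[]" "copies (?n\<^sup>2) [False] @ [True]"]
      unfolding nat_word_special_numerator[OF n]
      by (simp add: pair_word_Cons pair_word_replicate pair_word_Nil power2_eq_square)
    finally have w: "rat_word (weight N (P \<union> Q) i x) = ?v6"
      using 3 by (simp add: weight_def)
    have each2: "ex (emit_each 2 out [False, False]) (ts(2 := (int (Suc (Suc 0)), cells_of x), out := wtape 0 ?v1))
      ((?n - 2) * 8 + 1) (ts(2 := (int ?n, cells_of x), out := wtape 0 ?v2))"
      using each[of 2 "[False, False]" ?v1] n by (simp add: numeral_2_eq_2)
    have sq1: "ex (emit_square out [True, True]) (ts(2 := (int (Suc 0), cells_of x), out := wtape 0 ?v2))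
      ((?n - 1) * (?n * 10 + 12) + 1) (ts(2 := (int ?n, cells_of x), out := wtape 0 ?v3))"
      using sq[of 1 "[True, True]" ?v2] n by simp
    have le: "(?n - 1) * (?n * 10 + 12) \<le> ?n * (?n * 10 + 12)" by (rule mult_right_mono) auto
    have "ex (answer N out M1 M2) ts ?T (ts(2 := (int ?n, cells_of x), out := wtape 0 ?v6))"
      unfolding answer_def
      apply (rule exec.CondF[OF _ exec.CondF[OF _ exec.CondT[OF _
         exec.Seq[OF em[of _ 0 "[]", folded t0] exec.Seq[OF rt exec.Seq[OF rt exec.Seq[OF each2
         exec.Seq[OF rw exec.Seq[OF rt exec.Seq[OF sq1 exec.Seq[OF em exec.Seq[OF rw exec.Seq[OF sq em
         order.refl] order.refl] order.refl] order.refl] order.refl] order.refl] order.refl] order.refl] order.refl] order.refl]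
         order.refl] order.refl]])
      using r 3 n le by (simp_all add: algebra_simps)
    then show ?thesis unfolding w by (intro exI conjI, assumption) simp
  next
    case 4
    have w: "rat_word (weight N (P \<union> Q) i x) =
      (([] @ [False, False, True, True, False, True]) @ copies ((?n - 0) * ?n) [False]) @ [True]"
      using 4 one[of "?n\<^sup>2"] by (simp add: weight_def power2_eq_square)
    have "ex (answer N out M1 M2) ts ?T (ts(2 := (int ?n, cells_of x),
        out := wtape 0 ((([] @ [False, False, True, True, False, True]) @ copies ((?n - 0) * ?n) [False]) @ [True])))"
      unfolding answer_def
      by (rule exec.CondF[OF _ exec.CondF[OF _ exec.CondF[OF _ exec.Seq[OF em[of _ 0 "[]", folded t0]
            exec.Seq[OF sq em order.refl] order.refl] order.refl] order.refl]])
        (use r 4 in \<open>auto simp: algebra_simps\<close>)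
    then show ?thesis unfolding w by (intro exI conjI, assumption) simp
  qed
qed

lemma ex_main_prog:
  assumes P: "wf_tm M1" "fst (run M1 x t1) = (if x \<in> P then acc M1 else rej M1)"
    and Q: "wf_tm M2" "fst (run M2 x t2) = (if x \<in> Q then acc M2 else rej M2)"
    and G: "tm_symbols M1 \<subseteq> G" "tm_symbols M2 \<subseteq> G" "\<And>c. c \<le> N \<Longrightarrow> Work c \<in> G" and N: "2 \<le> N"
    and K: "K = 9 + tapes M1 + tapes M2" and u: "u = pair_word (nat_word i) x" and L: "L = length u"
  shows "\<exists>ts'. ex (main_prog N M1 M2) (init_env u) (30 * (L * L) + 200 * L + 200 + 2 * t1 + 2 * t2) ts' \<and>
    ts' (8 + tapes M1 + tapes M2) = wtape 0 (rat_word (weight N (P \<union> Q) i x))"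
proof -
  let ?w = "nat_word i" and ?n = "length x"
  let ?b = "8 + tapes M1"
  let ?J = "{2, 3, 8, ?b}"
  let ?o = "?b + tapes M2"
  have k: "1 \<le> tapes M1" "1 \<le> tapes M2" "acc M1 \<noteq> rej M1" "acc M2 \<noteq> rej M2"
    using P(1) Q(1) by (auto simp: wf_tm_def)
  have G': "Work 0 \<in> G" "Work 1 \<in> G" using G(3) N by auto
  have len: "L = 2 * length ?w + 2 + ?n" using L u by (simp add: length_pair_word)
  have dr: "drop (2 * length ?w + 2) u = x" unfolding u by (rule drop_pair_word)
  let ?e1 = "(init_env u)(0 := (int (0 + 2 * length ?w + 2), cells_of u), 1 := wtape 0 ([] @ ?w), 4 := var (Work 0))"
  have 1: "ex parse (init_env u) (4 * length ?w + 5) ?e1"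
    using K G' u by (intro ex_parse[where x = x]) (auto simp: init_env_def wtape_Nil var_Blank)
  let ?e2 = "(\<lambda>_. blank_tape)(0 := (int L, cells_of u), 1 := (int (length ?w), cells_of ?w),
    2 := (int ?n, cells_of x), 3 := (int ?n, cells_of x), 8 := (int ?n, cells_of x), ?b := (int ?n, cells_of x),
    4 := var (Work 0))"
  have "ex (copy 0 ?J) ?e1 (2 * L + 1) (\<lambda>i. if i = 0 then (int (length u), cells_of u)
    else if i \<in> ?J then wtape 0 ([] @ drop (2 * length ?w + 2) u) else ?e1 i)"
    using K k len L by (intro ex_copy) (auto simp: init_env_def wtape_Nil)
  then have 2: "ex (copy 0 ?J) ?e1 (2 * L + 1) ?e2"
    by (rule exec_eq) (use k dr L in \<open>auto simp: fun_eq_iff wtape_def init_env_def\<close>)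
  let ?e3 = "(\<lambda>_. blank_tape)(0 := (int L, cells_of u), 1 := (int (length ?w), cells_of ?w),
    2 := (0, cells_of x), 3 := (0, cells_of x), 8 := (0, cells_of x), ?b := (0, cells_of x),
    4 := var (Work 0))"
  have 3: "ex (rewind 2 ?J) ?e2 (2 * ?n + 5) ?e3"
    by (rule exec_eq[OF ex_rewind[of ?J 2 ?e2 ?n x "2 * ?n + 5"]])
      (use K k in \<open>auto simp: slide_def fun_eq_iff\<close>)
  let ?e4 = "?e3(1 := (0, cells_of ?w))"
  have 4: "ex (rewind 1 {1}) ?e3 (2 * length ?w + 5) ?e4"
    by (rule exec_eq[OF ex_rewind[of "{1}" 1 ?e3 "length ?w" ?w "2 * length ?w + 5"]])
      (use K k in \<open>auto simp: slide_def fun_eq_iff\<close>)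
  let ?e5 = "?e4(7 := var (Work 0))"
  have 5: "ex (Act (\<lambda>_. [7 \<mapsto> (Work 0, Stay)])) ?e4 1 ?e5"
    using K G' k by (intro exec_Act) (auto simp flip: var_Blank)
  have "\<exists>v' good'. ex (count_down N) ?e5 ((?n - 0) * (4 * length ?w + 16) + 1)
      (?e5(1 := (0, cells_of v'), 2 := (int ?n, cells_of x), 4 := var (if good' then Work 0 else Work 1),
         7 := var (Work (min N ?n)))) \<and>
    length v' = length ?w \<and> (good' \<longleftrightarrow> True \<and> ?n - 0 \<le> val ?w) \<and> (good' \<longrightarrow> val v' = val ?w - (?n - 0))"
    using K k G(3) G' by (intro ex_count_down) auto
  then obtain v' good' where 6: "ex (count_down N) ?e5 (?n * (4 * length ?w + 16) + 1)
      (?e5(1 := (0, cells_of v'), 2 := (int ?n, cells_of x), 4 := var (if good' then Work 0 else Work 1),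
         7 := var (Work (min N ?n))))"
    and v': "length v' = length ?w" "good' \<longleftrightarrow> ?n \<le> i" "good' \<longrightarrow> val v' = i - ?n"
    by (auto simp: val_nat_word)
  let ?e6 = "?e5(1 := (0, cells_of v'), 2 := (int ?n, cells_of x), 4 := var (if good' then Work 0 else Work 1),
         7 := var (Work (min N ?n)))"
  let ?e7 = "?e5(1 := (0, cells_of v'), 2 := (0, cells_of x), 4 := var (if good' then Work 0 else Work 1),
         7 := var (Work (min N ?n)))"
  have 7: "ex (rewind 2 {2}) ?e6 (2 * ?n + 5) ?e7"
    by (rule exec_eq[OF ex_rewind[of "{2}" 2 ?e6 ?n x "2 * ?n + 5"]])
      (use K k in \<open>auto simp: slide_def fun_eq_iff\<close>)
  obtain t where 8: "ex test_zero ?e7 (2 * length v' + 10)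
    (?e7(1 := t, 4 := var (if val v' = 0 then (if good' then Work 0 else Work 1) else Work 1)))"
    using ex_test_zero[of ?e7 v' "if good' then Work 0 else Work 1"] K G' by auto
  let ?e8 = "?e7(1 := t, 4 := var (if val v' = 0 then (if good' then Work 0 else Work 1) else Work 1))"
  \<comment> \<open>Equality means that no underflow occurred and that the counter is used up. After
    an underflow both branches give \<open>Work 1\<close>, whatever the wrapped counter
    contains.\<close>
  have "(if val v' = 0 then (if good' then Work 0 else Work 1) else Work 1) = (if ?n = i then Work 0 else Work 1)"
    using v' by auto
  then have e8_4: "?e8 4 = var (if ?n = i then Work 0 else Work 1)" by simp
  have "\<exists>ts'. ex (simulate M1 5 8) ?e8 (2 * t1 + 3) ts' \<and> ts' 5 = var (Work (fst (run M1 x t1))) \<and>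
    (\<forall>i<tapes M1. \<exists>vt. marked (fresh M1) ((\<lambda>_. 0) i) (length x + t1) vt (ts' (8 + i))) \<and>
    (\<forall>i. i \<noteq> 5 \<and> \<not> (8 \<le> i \<and> i < 8 + tapes M1) \<longrightarrow> ts' i = ?e8 i)"
    by (rule ex_simulate[where s = Blank]) (use P G K k in \<open>auto simp: var_Blank wtape_Nil\<close>)
  then obtain e9 where 9: "ex (simulate M1 5 8) ?e8 (2 * t1 + 3) e9" "e9 5 = var (Work (fst (run M1 x t1)))"
    "\<And>i. i \<noteq> 5 \<and> \<not> (8 \<le> i \<and> i < 8 + tapes M1) \<Longrightarrow> e9 i = ?e8 i"
    by blast
  have e9: "e9 6 = var Blank" "e9 ?b = (0, cells_of x)" "\<And>i. ?b < i \<Longrightarrow> e9 i = blank_tape"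
    using 9(3) k by (auto simp: var_Blank)
  have "\<exists>ts'. ex (simulate M2 6 ?b) e9 (2 * t2 + 3) ts' \<and> ts' 6 = var (Work (fst (run M2 x t2))) \<and>
    (\<forall>i<tapes M2. \<exists>vt. marked (fresh M2) ((\<lambda>_. 0) i) (length x + t2) vt (ts' (?b + i))) \<and>
    (\<forall>i. i \<noteq> 6 \<and> \<not> (?b \<le> i \<and> i < ?b + tapes M2) \<longrightarrow> ts' i = e9 i)"
    by (rule ex_simulate[where s = Blank]) (use Q G K k e9 in \<open>auto simp: wtape_Nil\<close>)
  then obtain e10 where 10: "ex (simulate M2 6 ?b) e9 (2 * t2 + 3) e10" "e10 6 = var (Work (fst (run M2 x t2)))"
    "\<And>i. i \<noteq> 6 \<and> \<not> (?b \<le> i \<and> i < ?b + tapes M2) \<Longrightarrow> e10 i = e9 i"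
    by blast
  have same: "e10 i = ?e8 i" if "i \<in> {2, 3, 4, 7}" for i
    using 9(3)[of i] 10(3)[of i] that by auto
  have "\<exists>ts'. ex (answer N ?o M1 M2) e10 (20 * (length x * length x) + 80 * length x + 80) ts' \<and>
    ts' ?o = wtape 0 (rat_word (weight N (P \<union> Q) i x))"
  proof (rule ex_answer)
    show "e10 2 = (0, cells_of x)" "e10 3 = (0, cells_of x)" "e10 7 = var (Work (min N ?n))"
      using same[of 2] same[of 3] same[of 7] by simp_all
    show "e10 4 = var (if ?n = i then Work 0 else Work 1)" using same[of 4] e8_4 by simp
    show "e10 5 = var (Work (if x \<in> P then acc M1 else rej M1))" using 9(2) 10(3)[of 5] P(2) by simp
    show "e10 6 = var (Work (if x \<in> Q then acc M2 else rej M2))" using 10(2) Q(2) by simp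
    show "e10 ?o = wtape 0 []" using 10(3)[of ?o] e9(3)[of ?o] k by (simp add: wtape_Nil)
  qed (use K N k in auto)
  then obtain ts' where 11: "ex (answer N ?o M1 M2) e10 (20 * (?n * ?n) + 80 * ?n + 80) ts'"
    "ts' ?o = wtape 0 (rat_word (weight N (P \<union> Q) i x))" by blast
  have le: "?n * ?n \<le> L * L" "?n * length ?w \<le> L * L" "2 * (?n * length ?w) \<le> L * L" using len
    by (auto simp: algebra_simps intro!: mult_mono)
  have "ex (main_prog N M1 M2) (init_env u) (30 * (L * L) + 200 * L + 200 + 2 * t1 + 2 * t2) ts'"
    unfolding main_prog_def Let_def
    apply (rule exec.Seq[OF 1 exec.Seq[OF 2 exec.Seq[OF 3 exec.Seq[OF 4 exec.Seq[OF 5 exec.Seq[OF 6 exec.Seq[OF 7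
      exec.Seq[OF 8 exec.Seq[OF 9(1) exec.Seq[OF 10(1) 11(1) order.refl] order.refl] order.refl] order.refl]
      order.refl] order.refl] order.refl] order.refl] order.refl]])
    using le len v'(1) by (simp add: distrib_left mult.assoc mult.left_commute)
  then show ?thesis using 11(2) by blast
qed

end

text \<open>The simulated machines run on \<open>x\<close>, while the bound is stated in the length
  of the longer encoded pair; monotonicity bridges the two. The constant 201 includes the halting
  step.\<close>

theorem weight_computable:
  assumes P: "decides_in T1 M1 P" and Q: "decides_in T2 M2 Q" and N: "2 \<le> N" and mono: "mono T1" "mono T2"
  shows "\<exists>M :: nat tm. wf_tm M \<and> (\<forall>i x. let u = pair_word (nat_word i) x; L = length u in
    computes_within M (30 * L\<^sup>2 + 200 * L + 201 + 2 * T1 L + 2 * T2 L) u (rat_word (weight N (P \<union> Q) i x)))"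
proof -
  have wf: "wf_tm M1" "wf_tm M2" using P Q by (auto simp: decides_in_def)
  define K where "K = 9 + tapes M1 + tapes M2"
  define G where "G = {Blank, Bit False, Bit True} \<union> Work ` {..N} \<union> tm_symbols M1 \<union> tm_symbols M2"
  define M where "M = tm_of K G (main_prog N M1 M2) (\<lambda>_. True)"
  interpret bit_alphabet K G
  proof
    show "Bit b \<in> G" for b by (cases b) (auto simp: G_def)
  qed (simp add: G_def)
  have "wf_tm M"
    unfolding M_def by (rule wf_tm_of) (use wf in \<open>auto simp: G_def K_def finite_tm_symbols\<close>)
  moreover have "computes_within M (30 * L\<^sup>2 + 200 * L + 201 + 2 * T1 L + 2 * T2 L) u (rat_word (weight N (P \<union> Q) i x))"
    if u: "u = pair_word (nat_word i) x" and L: "L = length u" for u i x L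
  proof -
    obtain t1 where t1: "t1 \<le> T1 (length x)" "fst (run M1 x t1) = (if x \<in> P then acc M1 else rej M1)"
      using P by (auto simp: decides_in_def)
    obtain t2 where t2: "t2 \<le> T2 (length x)" "fst (run M2 x t2) = (if x \<in> Q then acc M2 else rej M2)"
      using Q by (auto simp: decides_in_def)
    obtain ts where ts: "ex (main_prog N M1 M2) (init_env u) (30 * (L * L) + 200 * L + 200 + 2 * t1 + 2 * t2) ts"
      "ts (8 + tapes M1 + tapes M2) = wtape 0 (rat_word (weight N (P \<union> Q) i x))"
      using ex_main_prog[OF wf(1) t1(2) wf(2) t2(2) _ _ _ N K_def u L] by (auto simp: G_def)
    obtain t where t: "t \<le> 30 * (L * L) + 200 * L + 200 + 2 * t1 + 2 * t2 + 1"
      "run M u t = (0, listed K ts)"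
      using run_tm_of[OF ts(1), of "\<lambda>_. True"] by (auto simp: M_def K_def)
    have "length x \<le> L" using u L by (simp add: length_pair_word)
    then have "T1 (length x) \<le> T1 L" "T2 (length x) \<le> T2 L" using mono by (auto dest: monoD)
    then have "t \<le> 30 * L\<^sup>2 + 200 * L + 201 + 2 * T1 L + 2 * T2 L"
      using t(1) t1(1) t2(1) by (simp add: power2_eq_square)
    moreover have "K = Suc (8 + tapes M1 + tapes M2)" by (simp add: K_def)
    then have "last (listed K ts) = ts (8 + tapes M1 + tapes M2)"
      by (simp only: listed_def upt_Suc) simp
    ultimately show ?thesis
      using t(2) ts(2) unfolding computes_within_def
      by (intro exI[of _ t]) (auto simp: halted_def M_def wtape_def)
  qed
  ultimately show ?thesis unfolding Let_def by blast
qed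

section \<open>The junta distribution\<close>

definition junta :: "nat \<Rightarrow> language \<Rightarrow> nat \<Rightarrow> word pmf" where
  "junta N S n = embed_pmf (\<lambda>x. of_rat (weight N S n x))"

lemma weight_nonneg: "0 \<le> weight N S n x"
  by (simp add: weight_def)

lemma finite_words: "finite {x :: word. length x = n}"
  using finite_lists_length_eq[of "UNIV :: bool set" n] by simp

lemma card_words: "card {x :: word. length x = n} = 2 ^ n"
  using card_lists_length_eq[of "UNIV :: bool set" n] by simp

section \<open>Arithmetic of the special weight\<close>

lemma special_numerator_pos: "0 < special_numerator n"
  by (simp add: special_numerator_def)

text \<open>The balance of the total mass in units of \<open>2^(-n^2)\<close>:
  \<open>2^n - 2\<close> ordinary words with one unit each and two special words. The 2 stands on
  the right to avoid truncated subtraction.\<close>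

lemma special_numerator_eq:
  assumes "2 \<le> n"
  shows "2 ^ n + 2 * special_numerator n = 2 + 2 ^ n\<^sup>2"
proof -
  have "n \<le> n\<^sup>2" by (simp add: power2_eq_square)
  then have 1: "(2::nat) ^ n * 2 ^ (n\<^sup>2 - n) = 2 ^ n\<^sup>2" by (simp flip: power_add)
  have 2: "2 * 2 ^ (n - 1) = (2::nat) ^ n" using assms by (cases n) auto
  obtain c where c: "(2::nat) ^ (n\<^sup>2 - n) = Suc c" by (cases "(2::nat) ^ (n\<^sup>2 - n)") auto
  have "2 * special_numerator n = 2 + (2 * 2 ^ (n - 1)) * c"
    unfolding special_numerator_def c by simp
  then show ?thesis using 1 unfolding 2 c by simp
qed

text \<open>Since \<open>n + 1 <= n^2\<close>, the ordinary words take at most half of the mass; the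
  two special words share the rest equally, so each has at least a quarter.\<close>

lemma special_numerator_ge:
  assumes "2 \<le> n"
  shows "2 ^ n\<^sup>2 \<le> 4 * special_numerator n"
proof -
  have "n + 1 \<le> 2 * n" using assms by simp
  also have "\<dots> \<le> n\<^sup>2" using assms by (simp add: power2_eq_square)
  finally have "(2::nat) ^ (n + 1) \<le> 2 ^ n\<^sup>2" by (rule power_increasing) simp
  then show ?thesis using special_numerator_eq[OF assms] by simp
qed

text \<open>The common setting of both cases: \<open>P\<close> and \<open>Q\<close> are the given
  piercing sets if these are unique, and their least words otherwise. \<open>2 <= N\<close> ensures
  the binary form of the numerator and a positive exponent \<open>n^2 - n\<close>.\<close>

locale piercing =
  fixes A P Q :: language and N :: nat
  assumes N: "2 \<le> N" and P: "P \<subseteq> A" and Q: "Q \<subseteq> - A"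
    and P_unique: "\<And>n. N \<le> n \<Longrightarrow> \<exists>!x. x \<in> P \<and> length x = n"
    and Q_unique: "\<And>n. N \<le> n \<Longrightarrow> \<exists>!x. x \<in> Q \<and> length x = n"
begin

lemma special_words:
  assumes "N \<le> n"
  obtains p q where "p \<in> P" "q \<in> Q" "length p = n" "length q = n" "p \<noteq> q"
    "{x \<in> P \<union> Q. length x = n} = {p, q}"
proof -
  obtain p where p: "p \<in> P" "length p = n" "\<And>x. x \<in> P \<Longrightarrow> length x = n \<Longrightarrow> x = p"
    using P_unique[OF assms] by blast
  obtain q where q: "q \<in> Q" "length q = n" "\<And>x. x \<in> Q \<Longrightarrow> length x = n \<Longrightarrow> x = q"
    using Q_unique[OF assms] by blast
  have "p \<noteq> q" using p q P Q by blast
  moreover have "{x \<in> P \<union> Q. length x = n} = {p, q}" using p q by blast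
  ultimately show thesis using that p q by blast
qed

lemma sum_weight: "(\<Sum>x | length x = n. weight N (P \<union> Q) n x) = 1"
proof (cases "n < N")
  case True
  then have "(\<Sum>x | length x = n. weight N (P \<union> Q) n x) = (\<Sum>x::word | length x = n. 1 / 2 ^ n)"
    by (intro sum.cong) (auto simp: weight_def)
  then show ?thesis by (simp add: card_words)
next
  case False
  then obtain p q where pq: "length p = n" "length q = n" "p \<noteq> q" "{x \<in> P \<union> Q. length x = n} = {p, q}"
    using special_words[of n] by (metis linorder_not_less)
  let ?W = "{x :: word. length x = n}"
  have S: "x \<in> P \<union> Q \<longleftrightarrow> x \<in> {p, q}" if "length x = n" for x using pq(4) that by blast
  have "(\<Sum>x\<in>?W. weight N (P \<union> Q) n x) =
    (\<Sum>x\<in>?W - {p, q}. weight N (P \<union> Q) n x) + (\<Sum>x\<in>{p, q}. weight N (P \<union> Q) n x)"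
    using pq finite_words by (intro sum.subset_diff) auto
  also have "(\<Sum>x\<in>?W - {p, q}. weight N (P \<union> Q) n x) = (\<Sum>x\<in>?W - {p, q}. 1 / 2 ^ n\<^sup>2)"
    using False S by (intro sum.cong) (auto simp: weight_def)
  also have "\<dots> = of_nat (2 ^ n - 2) / 2 ^ n\<^sup>2"
    using pq by (simp add: card_Diff_subset card_words)
  also have "(\<Sum>x\<in>{p, q}. weight N (P \<union> Q) n x) = (\<Sum>x\<in>{p, q}. of_nat (special_numerator n) / 2 ^ n\<^sup>2)"
    using False S pq by (intro sum.cong) (auto simp: weight_def)
  also have "\<dots> = of_nat (2 * special_numerator n) / 2 ^ n\<^sup>2" using pq by simp
  also have "of_nat (2 ^ n - 2) / 2 ^ n\<^sup>2 + of_nat (2 * special_numerator n) / 2 ^ n\<^sup>2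
     = (of_nat (2 ^ n - 2 + 2 * special_numerator n) / 2 ^ n\<^sup>2 :: rat)"
    by (simp only: of_nat_add add_divide_distrib)
  also have "2 ^ n - 2 + 2 * special_numerator n = 2 ^ n\<^sup>2"
  proof -
    have n: "2 \<le> n" using False N by simp
    have "(2::nat) ^ 1 \<le> 2 ^ n" using n by (intro power_increasing) auto
    then show ?thesis using special_numerator_eq[OF n] by simp
  qed
  finally show ?thesis by simp
qed

abbreviation \<mu> :: "nat \<Rightarrow> word pmf" where
  "\<mu> \<equiv> junta N (P \<union> Q)"

lemma pmf_junta: "pmf (\<mu> n) x = of_rat (weight N (P \<union> Q) n x)"
  unfolding junta_def
proof (rule pmf_embed_pmf)
  let ?f = "\<lambda>x. of_rat (weight N (P \<union> Q) n x) :: real"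
  let ?W = "{x :: word. length x = n}"
  have "(\<integral>\<^sup>+ x. ennreal (?f x) \<partial>count_space UNIV) = (\<Sum>x\<in>?W. ennreal (?f x))"
    by (rule nn_integral_count_space'[OF finite_words]) (auto simp: weight_def)
  also have "\<dots> = ennreal (\<Sum>x\<in>?W. ?f x)"
    by (rule sum_ennreal) (simp add: weight_nonneg)
  also have "(\<Sum>x\<in>?W. ?f x) = 1"
    using sum_weight[of n] by (simp flip: of_rat_sum)
  finally show "(\<integral>\<^sup>+ x. ennreal (?f x) \<partial>count_space UNIV) = 1" by simp
qed (simp add: weight_nonneg)

lemma pmf_junta_pos: "0 < pmf (\<mu> n) x \<longleftrightarrow> length x = n"
  by (simp add: pmf_junta weight_def special_numerator_pos)

lemma set_pmf_junta: "set_pmf (\<mu> n) = {x. length x = n}"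
  using pmf_junta_pos by (auto simp: set_pmf_eq' )

lemma pmf_junta_ge:
  assumes "length x = n"
  shows "1 / 2 ^ n\<^sup>2 \<le> pmf (\<mu> n) x"
proof -
  \<comment> \<open>This settles the uniform part below \<open>N\<close>, where each word has mass
    \<open>2^(-n)\<close>.\<close>
  have "(2::rat) ^ n \<le> 2 ^ n\<^sup>2"
    by (rule power_increasing) (auto simp: power2_eq_square)
  then have "1 / 2 ^ n\<^sup>2 \<le> weight N (P \<union> Q) n x"
    using assms by (auto simp: weight_def special_numerator_def frac_le divide_right_mono)
  then have "of_rat (1 / 2 ^ n\<^sup>2) \<le> pmf (\<mu> n) x" unfolding pmf_junta by (simp only: of_rat_less_eq)
  then show ?thesis by (simp add: of_rat_divide of_rat_power)
qed

lemma pmf_junta_special: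
  assumes "N \<le> n" "length x = n" "x \<in> P \<union> Q"
  shows "1 / 4 \<le> pmf (\<mu> n) x"
proof -
  have "2 \<le> n" using assms N by simp
  then have "real (2 ^ n\<^sup>2) \<le> real (4 * special_numerator n)"
    using special_numerator_ge of_nat_le_iff by blast
  then have "1 / 4 \<le> real (special_numerator n) / 2 ^ n\<^sup>2" by (simp add: le_divide_eq)
  also have "\<dots> = pmf (\<mu> n) x"
    using assms unfolding pmf_junta by (simp add: weight_def of_rat_divide of_rat_power)
  finally show ?thesis .
qed

lemma basic_junta:
  assumes "NP_hard A"
  shows "basic_junta A \<mu>"
proof -
  have "(\<Union>n. {x. length x = n \<and> pmf (\<mu> n) x > 0}) = UNIV"
    by (auto simp: pmf_junta_pos)
  then have "NP_hard_restricted (\<Union>n. {x. length x = n \<and> pmf (\<mu> n) x > 0}) A"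
    using assms by (simp add: NP_hard_def NP_hard_restricted_def many_one_reducible_def)
  moreover have "\<exists>c>1. \<exists>N. \<forall>n\<ge>N. 1 / c \<le> measure_pmf.prob (\<mu> n) {x. x \<in> A} \<and>
        measure_pmf.prob (\<mu> n) {x. x \<in> A} \<le> 1 - 1 / c"
  proof (intro exI[of _ "4::real"] exI[of _ N] conjI allI impI)
    fix n assume n: "N \<le> n"
    obtain p q where pq: "p \<in> P" "q \<in> Q" "length p = n" "length q = n"
      using special_words[OF n] by metis
    have "1 / 4 \<le> measure_pmf.prob (\<mu> n) {p}"
      using pmf_junta_special[OF n, of p] pq by (simp add: measure_pmf_single)
    also have "\<dots> \<le> measure_pmf.prob (\<mu> n) {x. x \<in> A}"
      using pq(1) P by (intro measure_pmf.finite_measure_mono) auto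
    finally show "1 / 4 \<le> measure_pmf.prob (\<mu> n) {x. x \<in> A}" .
    \<comment> \<open>The upper bound comes from the special negative word alone, as
      \<open>A\<close> misses \<open>q\<close>.\<close>
    have "measure_pmf.prob (\<mu> n) {x. x \<in> A} \<le> measure_pmf.prob (\<mu> n) (- {q})"
      using pq(2) Q by (intro measure_pmf.finite_measure_mono) auto
    also have "\<dots> = 1 - pmf (\<mu> n) q"
      using measure_pmf.prob_compl[of "{q}" "\<mu> n"] by (simp add: measure_pmf_single Compl_eq_Diff_UNIV)
    also have "\<dots> \<le> 1 - 1 / 4" using pmf_junta_special[OF n, of q] pq by simp
    finally show "measure_pmf.prob (\<mu> n) {x. x \<in> A} \<le> 1 - 1 / 4" .
  qed simp
  moreover have "\<forall>n x. length x = n \<longrightarrow> pmf (\<mu> n) x \<ge> 1 / 2 ^ poly (monom 1 2) n \<or> pmf (\<mu> n) x = 0"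
    using pmf_junta_ge by (simp add: poly_monom)
  ultimately show ?thesis
    unfolding basic_junta_def distribution_family_def set_pmf_junta by blast
qed

text \<open>The machine may accept anything between \<open>P\<close> and \<open>A\<close>. Then it
  errs only on words of \<open>A\<close> that it rejects; these lie outside \<open>P\<close>, which
  is accepted, and outside \<open>Q\<close>, which is disjoint from \<open>A\<close>. So each of
  them has the ordinary weight, and there are at most \<open>2^n\<close> of them.\<close>

lemma error_weight_le:
  assumes "N \<le> n" "P \<subseteq> {x. accepts M x}" "{x. accepts M x} \<subseteq> A"
  shows "error_weight A \<mu> M n \<le> 1 / 2 ^ (n\<^sup>2 - n)"
proof -
  let ?E = "{x. x \<notin> A \<longleftrightarrow> accepts M x}"
  let ?W = "{x :: word. length x = n}"
  have E: "x \<notin> P \<union> Q" if "x \<in> ?E" for x using that assms(2,3) Q by auto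
  have "error_weight A \<mu> M n = measure_pmf.prob (\<mu> n) (?E \<inter> ?W)"
    unfolding error_weight_def using measure_Int_set_pmf[of "\<mu> n" ?E] by (simp only: set_pmf_junta)
  also have "\<dots> = (\<Sum>x\<in>?E \<inter> ?W. pmf (\<mu> n) x)"
    by (rule measure_measure_pmf_finite) (simp add: finite_words)
  also have "\<dots> = (\<Sum>x\<in>?E \<inter> ?W. 1 / 2 ^ n\<^sup>2)"
    using assms(1) E unfolding pmf_junta
    by (intro sum.cong) (auto simp: weight_def of_rat_divide of_rat_power)
  also have "\<dots> \<le> (\<Sum>x\<in>?W. 1 / 2 ^ n\<^sup>2)"
    by (rule sum_mono2) (auto simp: finite_words)
  also have "\<dots> = 2 ^ n / 2 ^ n\<^sup>2" by (simp add: card_words)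
  also have "\<dots> = 1 / 2 ^ (n\<^sup>2 - n)"
  proof -
    have "n \<le> n\<^sup>2" by (simp add: power2_eq_square)
    then show ?thesis by (simp add: power_diff)
  qed
  finally show ?thesis .
qed

text \<open>The constant polynomial 1 serves as witness: \<open>n >= 2\<close> makes
  \<open>n^2 - n\<close> positive, so the error weight is strictly below 1. The sharp bound is
  stated separately in \<open>error_weight_le\<close>.\<close>

lemma heuristic:
  assumes "poly_time_tm M" "P \<subseteq> {x. accepts M x}" "{x. accepts M x} \<subseteq> A"
  shows "heuristic_poly_time A \<mu> M"
proof -
  have "error_weight A \<mu> M n < 1 / real (poly 1 n)" if "N \<le> n" for n
  proof -
    have "2 \<le> n" using that N by simp
    then have "0 < n\<^sup>2 - n" by (simp add: power2_eq_square)
    then have "(1::real) < 2 ^ (n\<^sup>2 - n)" by (intro one_less_power) auto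
    then have "1 / 2 ^ (n\<^sup>2 - n) < (1::real)" by simp
    from order.strict_trans1[OF error_weight_le[OF that assms(2,3)] this] show ?thesis by simp
  qed
  then show ?thesis unfolding heuristic_poly_time_def using assms(1) by blast
qed

lemma uniformly_computable:
  assumes "decides_in T1 M1 P" "decides_in T2 M2 Q" "mono T1" "mono T2"
    and T: "\<And>n. 30 * n\<^sup>2 + 200 * n + 201 + 2 * T1 n + 2 * T2 n \<le> T n"
  shows "uniformly_computable_in T \<mu>"
proof -
  have mono: "computes_within M t u v \<Longrightarrow> t \<le> t' \<Longrightarrow> computes_within M t' u v" for M :: "nat tm" and t t' u v
    unfolding computes_within_def by (meson le_trans)
  obtain M :: "nat tm" where "wf_tm M" "\<And>i x. let u = pair_word (nat_word i) x; L = length u in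
    computes_within M (30 * L\<^sup>2 + 200 * L + 201 + 2 * T1 L + 2 * T2 L) u (rat_word (weight N (P \<union> Q) i x))"
    using weight_computable[OF assms(1,2) N assms(3,4)] by blast
  then show ?thesis
    unfolding uniformly_computable_in_def Let_def using pmf_junta mono[OF _ T] by blast
qed

end

section \<open>Time bounds and the choice of the special words\<close>

lemma mono_poly_nat: "mono (poly (p :: nat poly))"
proof (induction p)
  case (pCons a p)
  then show ?case by (auto simp: mono_def intro!: mult_mono)
qed (simp add: mono_def)

lemma power2_add_le: "a \<le> 2 ^ m \<Longrightarrow> b \<le> 2 ^ n \<Longrightarrow> a + b \<le> (2::nat) ^ (m + n + 1)"
proof -
  assume ab: "a \<le> 2 ^ m" "b \<le> 2 ^ n"
  have "(2::nat) ^ m \<le> 2 ^ (m + n)" "(2::nat) ^ n \<le> 2 ^ (m + n)" by (rule power_increasing; simp)+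
  moreover have "(2::nat) ^ (m + n + 1) = 2 * 2 ^ (m + n)" by simp
  ultimately show ?thesis using ab by linarith
qed

lemma first_time_bounded:
  fixes p :: "nat poly" and k :: nat
  defines "T \<equiv> \<lambda>n. 2 ^ n * (k * (n + poly p n + 10)) + 2"
  shows "mono T" and "\<exists>q :: nat poly. \<forall>n. 2 * T n \<le> 2 ^ poly q n"
proof -
  show "mono T"
    unfolding T_def by (intro monoI add_mono mult_mono power_increasing monoD[OF mono_poly_nat]) auto
  \<comment> \<open>Bounding the polynomial factor by 2 to itself moves it into the exponent. Of the
    constant 3, two units come from the factor 4 that absorbs the summand 2, and one from the outer
    factor 2.\<close>
  have "2 * T n \<le> 2 ^ poly ([:3, 1:] + smult k ([:10, 1:] + p)) n" for n
  proof -
    let ?m = "k * (n + poly p n + 10)"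
    have "?m \<le> 2 ^ ?m" by (simp add: less_imp_le)
    then have "T n \<le> 2 ^ n * 2 ^ ?m + 2" by (simp add: T_def)
    also have "\<dots> \<le> 4 * (2 ^ n * 2 ^ ?m)"
    proof -
      have "(1::nat) \<le> 2 ^ n * 2 ^ ?m" unfolding power_add[symmetric] by (rule one_le_power) simp
      then show ?thesis by linarith
    qed
    also have "2 * \<dots> = 2 ^ (n + ?m + 3)" by (simp add: power_add)
    finally show ?thesis by (simp add: algebra_simps)
  qed
  then show "\<exists>q :: nat poly. \<forall>n. 2 * T n \<le> 2 ^ poly q n" by blast
qed

lemma first_subset: "first L \<subseteq> L"
  by (auto simp: first_def)

lemma first_unique:
  assumes "x \<in> L" "length x = n"
  shows "\<exists>!y. y \<in> first L \<and> length y = n"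
proof -
  obtain y where y: "y \<in> L" "length y = n" "\<And>z. z \<in> L \<Longrightarrow> length z = n \<Longrightarrow> val y \<le> val z"
    using ex_has_least_nat[of "\<lambda>y. y \<in> L \<and> length y = n" x val] assms by blast
  have "y \<in> first L" using y by (fastforce simp: first_def)
  moreover have "z = y" if "z \<in> first L" "length z = n" for z
  proof (rule val_inj)
    have "\<not> val y < val z" using that y(1,2) by (auto simp: first_def)
    moreover have "val y \<le> val z" using that y(3) first_subset by blast
    ultimately show "val z = val y" by simp
  qed (simp add: that y(2))
  ultimately show ?thesis using y(2) by blast
qed

theorem theorem3p6:
  fixes A :: language
  assumes "NP_hard A" and "well_pierced A"
  shows "\<exists>\<mu> :: nat \<Rightarrow> word pmf.
    basic_junta A \<mu> \<and>
    (\<exists>M :: nat tm. heuristic_poly_time A \<mu> M \<and>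
      (\<exists>N. \<forall>n\<ge>N. error_weight A \<mu> M n \<le> 1 / 2 ^ (n^2 - n))) \<and>
    uniformly_computable_exp_time \<mu> \<and>
    (uniquely_well_pierced A \<longrightarrow> uniformly_computable_poly_time \<mu>)"
proof (cases "uniquely_well_pierced A")
  \<comment> \<open>Both computability claims concern one family, so the piercing sets have to be
    fixed before it is built. If some pair is unique it is used directly, and the polynomial bound
    implies the exponential one; in the other case the polynomial claim is vacuous.\<close>
  case True
  then obtain Pos Neg N0 where PN: "Pos \<in> class_P" "Neg \<in> class_P" "Pos \<subseteq> A" "Neg \<subseteq> - A"
    and N0: "\<And>n. N0 \<le> n \<Longrightarrow> (\<exists>!x. x \<in> Pos \<and> length x = n) \<and> (\<exists>!x. x \<in> Neg \<and> length x = n)"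
    unfolding uniquely_well_pierced_def by blast
  interpret piercing A Pos Neg "max 2 N0"
    using PN N0 by unfold_locales auto
  obtain M1 p1 where M1: "decides_in (poly p1) M1 Pos" "poly_time_tm M1" "Pos = {w. accepts M1 w}"
    using class_P_decides_in[OF PN(1)] .
  obtain M2 p2 where M2: "decides_in (poly p2) M2 Neg"
    using class_P_decides_in[OF PN(2)] .
  let ?p = "[:201, 200, 30:] + smult 2 p1 + smult 2 p2"
  have T: "uniformly_computable_in T \<mu>" if "\<And>n. poly ?p n \<le> T n" for T
    using that by (intro uniformly_computable[OF M1(1) M2 mono_poly_nat mono_poly_nat])
      (simp add: power2_eq_square algebra_simps)
  have "uniformly_computable_in (poly ?p) \<mu>" by (rule T) simp
  moreover have "uniformly_computable_in (\<lambda>n. 2 ^ poly ?p n) \<mu>"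
    by (rule T, rule less_imp_le, rule less_exp)
  ultimately have "uniformly_computable_poly_time \<mu>" "uniformly_computable_exp_time \<mu>"
    unfolding uniformly_computable_poly_time_def uniformly_computable_exp_time_def by blast+
  moreover have "heuristic_poly_time A \<mu> M1" "\<forall>n\<ge>max 2 N0. error_weight A \<mu> M1 n \<le> 1 / 2 ^ (n\<^sup>2 - n)"
    using heuristic[OF M1(2)] error_weight_le[of _ M1] M1(3) PN(3) by blast+
  ultimately show ?thesis using basic_junta[OF assms(1)] by blast
next
  case False
  obtain Pos Neg N0 where PN: "Pos \<in> class_P" "Neg \<in> class_P" "Pos \<subseteq> A" "Neg \<subseteq> - A"
    and N0: "\<And>n. N0 \<le> n \<Longrightarrow> (\<exists>x. x \<in> Pos \<and> length x = n) \<and> (\<exists>x. x \<in> Neg \<and> length x = n)"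
    using assms(2) unfolding well_pierced_def by blast
  interpret piercing A "first Pos" "first Neg" "max 2 N0"
  proof
    show "\<exists>!x. x \<in> first Pos \<and> length x = n" "\<exists>!x. x \<in> first Neg \<and> length x = n" if "max 2 N0 \<le> n" for n
      using N0[of n] that by (metis first_unique max.bounded_iff)+
  qed (use PN first_subset in auto)
  \<comment> \<open>The heuristic is the polynomial-time machine for all of \<open>Pos\<close>,
    although the special words come from \<open>first Pos\<close>: its accepted set lies between
    \<open>first Pos\<close> and \<open>A\<close>.\<close>
  obtain M p where M: "decides_in (poly p) M Pos" "poly_time_tm M" "Pos = {w. accepts M w}"
    using class_P_decides_in[OF PN(1)] .
  obtain M' p' where M': "decides_in (poly p') M' Neg"
    using class_P_decides_in[OF PN(2)] .
  obtain M1 k1 where M1: "decides_in (\<lambda>n. 2 ^ n * (k1 * (n + poly p n + 10)) + 2) M1 (first Pos)"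
    using decides_in_first[OF M(1)] by blast
  obtain M2 k2 where M2: "decides_in (\<lambda>n. 2 ^ n * (k2 * (n + poly p' n + 10)) + 2) M2 (first Neg)"
    using decides_in_first[OF M'] by blast
  obtain q1 :: "nat poly" where q1: "\<And>n. 2 * (2 ^ n * (k1 * (n + poly p n + 10)) + 2) \<le> 2 ^ poly q1 n"
    using first_time_bounded(2)[where k = k1 and p = p] by blast
  obtain q2 :: "nat poly" where q2: "\<And>n. 2 * (2 ^ n * (k2 * (n + poly p' n + 10)) + 2) \<le> 2 ^ poly q2 n"
    using first_time_bounded(2)[where k = k2 and p = p'] by blast
  \<comment> \<open>Each of the two summands 1 pays for one application of
    \<open>power2_add_le\<close>, which adds powers of two at the price of one in the
    exponent.\<close>
  let ?q = "[:201, 200, 30:] + q1 + 1 + q2 + 1"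
  have "uniformly_computable_in (\<lambda>n. 2 ^ poly ?q n) \<mu>"
  proof (rule uniformly_computable[OF M1 M2 first_time_bounded(1) first_time_bounded(1)])
    fix n :: nat
    have "30 * n\<^sup>2 + 200 * n + 201 = poly [:201, 200, 30:] n"
      by (simp add: power2_eq_square algebra_simps)
    also have "\<dots> \<le> 2 ^ poly [:201, 200, 30:] n" by (rule less_imp_le, rule less_exp)
    finally show "30 * n\<^sup>2 + 200 * n + 201 + 2 * (2 ^ n * (k1 * (n + poly p n + 10)) + 2)
      + 2 * (2 ^ n * (k2 * (n + poly p' n + 10)) + 2) \<le> 2 ^ poly ?q n"
      using power2_add_le[OF power2_add_le[OF _ q1] q2] by (simp only: poly_add poly_1)
  qed
  then have "uniformly_computable_exp_time \<mu>" unfolding uniformly_computable_exp_time_def by blast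
  moreover have "heuristic_poly_time A \<mu> M" "\<forall>n\<ge>max 2 N0. error_weight A \<mu> M n \<le> 1 / 2 ^ (n\<^sup>2 - n)"
    using heuristic[OF M(2)] error_weight_le[of _ M] M(3) PN(3) first_subset by blast+
  ultimately show ?thesis using basic_junta[OF assms(1)] False by blast
qed

end
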